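(* Let $k$ be a field, let $A$ be a central simple $k$-algebra, let $F \subset A$ be a separable maximal commutative subalgebra, and let $v \in A$ be such that $A = FvF$. Then there is a cocycle $c \in Z^2_{Am}(k,F)$ such that the $k$-linear map $$\Phi_v\colon F^{\otimes 2} \to A,\qquad r_1 \otimes r_2 \mapsto r_1 v r_2,$$ is an isomorphism of $k$-algebras from $A(F,c)$ to $A$. Furthermore, $c$ is the unique element of $F^{\otimes 3}$ with this property (where the definition of the multiplication of $A(F,c)$ on $F^{\otimes 2}$ is extended to arbitrary, not necessarily cocycle, elements $c\in F^{\otimes 3}$).
   Context: $FvF$ denotes the $k$-linear span of the elements $r_1vr_2$ with $r_1,r_2\in F$. A commutative subalgebra is separable if it is étale over $k$. Tensor products are over $k$; $F^{\otimes n}$ is the tensor product of $n$ copies of $F$. For $n\ge 0$, $C^n_{Am}(k,F)=(F^{\otimes n+1})^\times$. For $0\le i\le n+1$, $\varepsilon_i^n\colon F^{\otimes n+1}\to F^{\otimes n+2}$ is the $k$-algebra homomorphism with $\varepsilon_i^n(f_0\otimes\cdots\otimes f_n)=f_0\otimes\cdots\otimes f_{i-1}\otimes 1\otimes f_i\otimes\cdots\otimes f_n$. Set $\Delta^n_{Am}(a)=\prod_{i=0}^{n+1}\varepsilon_i^n(a)^{(-1)^i}$ for $a \in C^n_{Am}(k,F)$, and $Z^n_{Am}(k,F)=\mathrm{Ker}(\Delta^n_{Am})$, whose elements are called $n$-cocycles. For $c\in Z^2_{Am}(k,F)$, $A(F,c)$ is the $k$-algebra whose underlying vector space is $F^{\otimes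 2}$, with multiplication $$a\,a'=\mathrm{Tr}_{F^{\otimes 3}/F^{\otimes 2}}\left(\varepsilon_2^1(a)\,c\,\varepsilon_0^1(a')\right),$$ where the product inside the trace is the usual one of $F^{\otimes 3}$ and $F^{\otimes 3}$ is an $F^{\otimes 2}$-algebra via $\varepsilon_1^1$; explicitly $\mathrm{Tr}_{F^{\otimes 3}/F^{\otimes 2}}(a_0\otimes a_1\otimes a_2)=\mathrm{Tr}_{F/k}(a_1)\,(a_0\otimes a_2)$. *)

theory Defs
  imports
    "HOL-Algebra.QuotRing"
    "HOL-Algebra.Module"
    "HOL-Library.Poly_Mapping"
    "HOL-Computational_Algebra.Polynomial"
begin

section \<open>Algebras over a field\<close>

text \<open>
  The base field is the type \<open>'k\<close>, the algebra is the type \<open>'a\<close>, and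
  \<open>scale\<close> is the scalar multiplication.  Subalgebras are subsets of \<open>'a\<close>.
\<close>

locale k_algebra = vector_space scale
  for scale :: "'k::field \<Rightarrow> 'a::ring_1 \<Rightarrow> 'a" (infixr "*s" 75) +
  assumes scale_mult_left: "(a *s x) * y = a *s (x * y)"
    and scale_mult_right: "x * (a *s y) = a *s (x * y)"
begin

definition two_sided_ideal :: "'a set \<Rightarrow> bool" where
  "two_sided_ideal I \<longleftrightarrow>
     0 \<in> I \<and> (\<forall>x\<in>I. \<forall>y\<in>I. x + y \<in> I) \<and> (\<forall>x\<in>I. \<forall>r. r * x \<in> I \<and> x * r \<in> I)"

definition subalgebra :: "'a set \<Rightarrow> bool" where
  "subalgebra F \<longleftrightarrow> subspace F \<and> 1 \<in> F \<and> (\<forall>x\<in>F. \<forall>y\<in>F. x * y \<in> F)"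

definition comm_subalgebra :: "'a set \<Rightarrow> bool" where
  "comm_subalgebra F \<longleftrightarrow> subalgebra F \<and> (\<forall>x\<in>F. \<forall>y\<in>F. x * y = y * x)"

definition maximal_comm_subalgebra :: "'a set \<Rightarrow> bool" where
  "maximal_comm_subalgebra F \<longleftrightarrow>
     comm_subalgebra F \<and> (\<forall>G. comm_subalgebra G \<and> F \<subseteq> G \<longrightarrow> G = F)"

text \<open>
  \<open>F\<close> is etale over \<open>k\<close> if it is a finite product of finite separable field extensions
  of \<open>k\<close>.  The decomposition is written through the orthogonal idempotents \<open>e \<in> E\<close> that are the
  units of the factors: the factor belonging to \<open>e\<close> is \<open>F e\<close>, with unit element \<open>e\<close>.
  In the definition of separability, \<open>p\<close> is the minimal polynomial of \<open>x\<close> (up to a scalar)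
  in the field \<open>F e\<close>; the powers of \<open>x\<close> are taken there, so that \<open>x\<close> to the power \<open>0\<close> is \<open>e\<close>.
\<close>

definition factor_field :: "'a set \<Rightarrow> 'a \<Rightarrow> bool" where
  "factor_field F e \<longleftrightarrow>
     e \<noteq> 0 \<and> (\<forall>x\<in>(\<lambda>f. f * e) ` F. x \<noteq> 0 \<longrightarrow> (\<exists>y\<in>(\<lambda>f. f * e) ` F. x * y = e))"

definition factor_separable :: "'a set \<Rightarrow> 'a \<Rightarrow> bool" where
  "factor_separable F e \<longleftrightarrow>
     (\<forall>x\<in>(\<lambda>f. f * e) ` F. \<exists>p::'k poly.
        irreducible p \<and> coprime p (pderiv p) \<and>
        (\<Sum>i\<le>Polynomial.degree p. coeff p i *s (x ^ i * e)) = 0)"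

definition etale_subalgebra :: "'a set \<Rightarrow> bool" where
  "etale_subalgebra F \<longleftrightarrow>
     comm_subalgebra F \<and> (\<exists>B. finite B \<and> span B = F) \<and>
     (\<exists>E. finite E \<and> E \<subseteq> F \<and>
        (\<forall>e\<in>E. e * e = e) \<and> (\<forall>e\<in>E. \<forall>e'\<in>E. e \<noteq> e' \<longrightarrow> e * e' = 0) \<and> (\<Sum>e\<in>E. e) = 1 \<and>
        (\<forall>e\<in>E. factor_field F e \<and> factor_separable F e))"

text \<open>The trace over \<open>k\<close> of multiplication by \<open>f\<close> on \<open>F\<close>, computed in some basis of \<open>F\<close>.\<close>

definition Tr :: "'a set \<Rightarrow> 'a \<Rightarrow> 'k" where
  "Tr F f = (let B = (SOME B. B \<subseteq> F \<and> independent B \<and> span B = F)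
             in \<Sum>b\<in>B. representation B (f * b) b)"

definition bimodule_span :: "'a set \<Rightarrow> 'a \<Rightarrow> 'a set" where
  "bimodule_span F v = span {r\<^sub>1 * v * r\<^sub>2 | r\<^sub>1 r\<^sub>2. r\<^sub>1 \<in> F \<and> r\<^sub>2 \<in> F}"


section \<open>Tensor powers\<close>

text \<open>
  \<open>tensor_power F n\<close> is the quotient of the vector space with basis the \<open>n\<close>-tuples in \<open>F\<close>
  (written as lists) by the subspace spanned by the multilinearity relations.  The vector space
  is regarded as a ring, namely as the monoid algebra of the \<open>n\<close>-tuples under componentwise
  multiplication; the subspace is an ideal when \<open>F\<close> is a subalgebra.
  The basis element of \<open>xs\<close> is \<open>Poly_Mapping.single xs 1\<close>.
\<close>

definition tuples :: "'a set \<Rightarrow> nat \<Rightarrow> 'a list set" where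
  "tuples F n = {xs. length xs = n \<and> set xs \<subseteq> F}"

definition formal_ring :: "'a set \<Rightarrow> nat \<Rightarrow> ('a list \<Rightarrow>\<^sub>0 'k) ring" where
  "formal_ring F n =
     \<lparr>carrier = {p. Poly_Mapping.keys p \<subseteq> tuples F n},
      monoid.mult = (\<lambda>p q. \<Sum>xs\<in>Poly_Mapping.keys p. \<Sum>ys\<in>Poly_Mapping.keys q.
                Poly_Mapping.single (map2 (*) xs ys)
                  (Poly_Mapping.lookup p xs * Poly_Mapping.lookup q ys)),
      one = Poly_Mapping.single (replicate n 1) 1,
      zero = 0,
      add = (+)\<rparr>"

definition formal_scale :: "'k \<Rightarrow> ('a list \<Rightarrow>\<^sub>0 'k) \<Rightarrow> ('a list \<Rightarrow>\<^sub>0 'k)" where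
  "formal_scale a p = Poly_Mapping.map ((*) a) p"

definition tensor_relations :: "'a set \<Rightarrow> nat \<Rightarrow> ('a list \<Rightarrow>\<^sub>0 'k) set" where
  "tensor_relations F n = Modules.module.span formal_scale
     ({Poly_Mapping.single (us @ (x + y) # ws) 1
         - Poly_Mapping.single (us @ x # ws) 1 - Poly_Mapping.single (us @ y # ws) 1
       | us x y ws. us @ x # ws \<in> tuples F n \<and> y \<in> F}
      \<union> {Poly_Mapping.single (us @ (a *s x) # ws) 1
           - formal_scale a (Poly_Mapping.single (us @ x # ws) 1)
         | us x a ws. us @ x # ws \<in> tuples F n})"

abbreviation tensor_class :: "'a set \<Rightarrow> nat \<Rightarrow> ('a list \<Rightarrow>\<^sub>0 'k) \<Rightarrow> ('a list \<Rightarrow>\<^sub>0 'k) set" where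
  "tensor_class F n p \<equiv> tensor_relations F n +>\<^bsub>formal_ring F n\<^esub> p"

definition tensor_power :: "'a set \<Rightarrow> nat \<Rightarrow> ('k, ('a list \<Rightarrow>\<^sub>0 'k) set) module" where
  "tensor_power F n = (let Q = formal_ring F n Quot tensor_relations F n in
     \<lparr>carrier = carrier Q, monoid.mult = monoid.mult Q, one = one Q, zero = zero Q, add = add Q,
      module.smult = (\<lambda>a X. \<Union>p\<in>X. tensor_class F n (formal_scale a p))\<rparr>)"

text \<open>
  The map into \<open>tensor_power F n\<close> induced by a map \<open>g\<close> of formal sums that is compatible with
  the relations.
\<close>

definition induced_map ::
  "'a set \<Rightarrow> nat \<Rightarrow> (('a list \<Rightarrow>\<^sub>0 'k) \<Rightarrow> ('a list \<Rightarrow>\<^sub>0 'k)) \<Rightarrow>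
   ('a list \<Rightarrow>\<^sub>0 'k) set \<Rightarrow> ('a list \<Rightarrow>\<^sub>0 'k) set" where
  "induced_map F n g X = (\<Union>p\<in>X. tensor_class F n (g p))"


section \<open>Amitsur cohomology\<close>

text \<open>\<open>face F n i\<close> is \<open>\<epsilon>\<^sub>i\<^sup>n\<close>, which goes from the power \<open>n + 1\<close> to the power \<open>n + 2\<close>.\<close>

definition face ::
  "'a set \<Rightarrow> nat \<Rightarrow> nat \<Rightarrow> ('a list \<Rightarrow>\<^sub>0 'k) set \<Rightarrow> ('a list \<Rightarrow>\<^sub>0 'k) set" where
  "face F n i = induced_map F (n + 2)
     (\<lambda>p. \<Sum>xs\<in>Poly_Mapping.keys p.
        Poly_Mapping.single (take i xs @ 1 # drop i xs) (Poly_Mapping.lookup p xs))"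

definition C_Am :: "'a set \<Rightarrow> nat \<Rightarrow> ('a list \<Rightarrow>\<^sub>0 'k) set monoid" where
  "C_Am F n = units_of (tensor_power F (n + 1))"

definition Delta_Am :: "'a set \<Rightarrow> nat \<Rightarrow> ('a list \<Rightarrow>\<^sub>0 'k) set \<Rightarrow> ('a list \<Rightarrow>\<^sub>0 'k) set" where
  "Delta_Am F n a =
     (\<Otimes>\<^bsub>C_Am F (n + 1)\<^esub>i\<in>{0..n + 1}. face F n i a [^]\<^bsub>C_Am F (n + 1)\<^esub> ((- 1) ^ i :: int))"

definition Z_Am :: "'a set \<Rightarrow> nat \<Rightarrow> ('a list \<Rightarrow>\<^sub>0 'k) set set" where
  "Z_Am F n = kernel (C_Am F n) (C_Am F (n + 1)) (Delta_Am F n)"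


section \<open>The algebra defined by a cocycle\<close>

text \<open>The trace from the third to the second tensor power, \<open>a\<^sub>0 \<otimes> a\<^sub>1 \<otimes> a\<^sub>2 \<mapsto> Tr(a\<^sub>1) (a\<^sub>0 \<otimes> a\<^sub>2)\<close>.\<close>

definition Tr32 :: "'a set \<Rightarrow> ('a list \<Rightarrow>\<^sub>0 'k) set \<Rightarrow> ('a list \<Rightarrow>\<^sub>0 'k) set" where
  "Tr32 F = induced_map F 2
     (\<lambda>p. \<Sum>xs\<in>Poly_Mapping.keys p.
        Poly_Mapping.single [xs ! 0, xs ! 2] (Tr F (xs ! 1) * Poly_Mapping.lookup p xs))"

definition cocycle_mult ::
  "'a set \<Rightarrow> ('a list \<Rightarrow>\<^sub>0 'k) set \<Rightarrow> ('a list \<Rightarrow>\<^sub>0 'k) set \<Rightarrow> ('a list \<Rightarrow>\<^sub>0 'k) set \<Rightarrow>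
   ('a list \<Rightarrow>\<^sub>0 'k) set" where
  "cocycle_mult F c a a' =
     Tr32 F (face F 1 2 a \<otimes>\<^bsub>tensor_power F 3\<^esub> c \<otimes>\<^bsub>tensor_power F 3\<^esub> face F 1 0 a')"

text \<open>
  The multiplication makes sense for every \<open>c\<close>.  The unit element is the one belonging to it;
  for \<open>c\<close> that are not cocycles it need not exist.
\<close>

definition cocycle_algebra ::
  "'a set \<Rightarrow> ('a list \<Rightarrow>\<^sub>0 'k) set \<Rightarrow> ('k, ('a list \<Rightarrow>\<^sub>0 'k) set) module" where
  "cocycle_algebra F c = (tensor_power F 2)
     \<lparr>monoid.mult := cocycle_mult F c,
      one := (THE u. u \<in> carrier (tensor_power F 2) \<and>
                (\<forall>a\<in>carrier (tensor_power F 2).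
                   cocycle_mult F c u a = a \<and> cocycle_mult F c a u = a))\<rparr>"

text \<open>
  The linear map \<open>r\<^sub>1 \<otimes> r\<^sub>2 \<mapsto> r\<^sub>1 v r\<^sub>2\<close>; the linear extension to formal sums is constant
  on each class.
\<close>

definition Phi :: "'a \<Rightarrow> ('a list \<Rightarrow>\<^sub>0 'k) set \<Rightarrow> 'a" where
  "Phi v X = the_elem
     ((\<lambda>p. \<Sum>xs\<in>Poly_Mapping.keys p. Poly_Mapping.lookup p xs *s (xs ! 0 * v * xs ! 1)) ` X)"

definition algebra_iso :: "('k, 'c) module \<Rightarrow> ('c \<Rightarrow> 'a) \<Rightarrow> bool" where
  "algebra_iso T h \<longleftrightarrow>
     bij_betw h (carrier T) UNIV \<and>
     (\<forall>x\<in>carrier T. \<forall>y\<in>carrier T. h (x \<oplus>\<^bsub>T\<^esub> y) = h x + h y \<and> h (x \<otimes>\<^bsub>T\<^esub> y) = h x * h y) \<and>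
     (\<forall>a. \<forall>x\<in>carrier T. h (a \<odot>\<^bsub>T\<^esub> x) = a *s h x) \<and>
     h \<one>\<^bsub>T\<^esub> = 1"

end

locale central_simple_algebra = k_algebra +
  assumes finite_dim: "\<exists>B. finite B \<and> span B = UNIV"
    and center: "{z. \<forall>x. z * x = x * z} = {a *s 1 | a. True}"
    and simple: "two_sided_ideal I \<Longrightarrow> I = {0} \<or> I = UNIV"

end

(* Put Phi(r (x) s) = r v s. Since A is central simple, A (x) A^op acts faithfully on A, so an
   element of the n-th tensor power of F is determined by the values of the words
   x_1 y_1 ... x_n y_n at all y_i in A. As A = FvF, it follows that Phi is injective. Let s be a
   separability idempotent of F. Then sum Tr(f s_0) s_1 = f, so the trace form of F is perfect, and
   there is a unique c with Phi(Tr_2(c (1 (x) x (x) 1))) = v x v for all x in F; this equation says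
   precisely that Phi is multiplicative for A(F,c). Evaluating v x v y v in two ways gives the
   cocycle identity. If c t = 0, then sum t_0 y t_1 z t_2 = 0 for all y, z in A, hence t = 0;
   so c is a non-zero-divisor in a finite dimensional algebra, and a unit. *)

theory Submission
  imports Defs
begin

context k_algebra
begin

section \<open>Formal sums and their linear extensions\<close>

text \<open>Tensor powers are quotients of formal sums, so the argument runs on representatives and
  passes to classes only at the end. Testing by words turns identities of tensors into identities in
  A. What remains is to reduce words to statements about v alone. If sum p_0 v p_1 = 0, then for r,
  s in F also sum p_0 r v s p_1 = r (sum p_0 v p_1) s = 0, F being commutative; hence sum p_0 z p_1
  = 0 for every z in FvF = A. With more than two entries the inner ones are in the way. Trace
  duality writes an inner entry f as sum Tr(f s_0) s_1: the trace is a scalar, and s_1 is absorbed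
  into z. This is why the middle entry of c is only ever seen under a trace. The separability
  idempotent is sought as an operator z -> sum x_i z y_i on A, because operators can be composed and
  corrected by commutators. Separability enters as invertibility of p'(x) in a factor field, and
  Taylor's formula turns it into a correction for one element x at a time.\<close>

definition formal :: "'a set \<Rightarrow> nat \<Rightarrow> ('a list \<Rightarrow>\<^sub>0 'k) set" where
  "formal F n = {p. Poly_Mapping.keys p \<subseteq> tuples F n}"

text \<open>All test maps take values in A: scalars such as traces and coordinates enter as
  coefficients of elements of A, so one codomain serves throughout.\<close>

definition lin :: "('a list \<Rightarrow> 'a) \<Rightarrow> ('a list \<Rightarrow>\<^sub>0 'k) \<Rightarrow> 'a" where
  "lin g p = (\<Sum>xs\<in>Poly_Mapping.keys p. Poly_Mapping.lookup p xs *s g xs)"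

lemma lin_eq_sum:
  assumes "finite S" "Poly_Mapping.keys p \<subseteq> S"
  shows "lin g p = (\<Sum>xs\<in>S. Poly_Mapping.lookup p xs *s g xs)"
  unfolding lin_def using assms by (intro sum.mono_neutral_left) (auto simp: in_keys_iff)

lemma lin_zero [simp]: "lin g 0 = 0"
  by (simp add: lin_def)

lemma lin_add: "lin g (p + q) = lin g p + lin g q"
proof -
  let ?S = "Poly_Mapping.keys p \<union> Poly_Mapping.keys q"
  have "lin g (p + q) = (\<Sum>xs\<in>?S. Poly_Mapping.lookup (p + q) xs *s g xs)"
    by (rule lin_eq_sum) (simp_all add: Poly_Mapping.keys_add)
  moreover have "lin g p = (\<Sum>xs\<in>?S. Poly_Mapping.lookup p xs *s g xs)"
    "lin g q = (\<Sum>xs\<in>?S. Poly_Mapping.lookup q xs *s g xs)"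
    by (rule lin_eq_sum; auto)+
  ultimately show ?thesis
    by (simp add: lookup_add scale_left_distrib sum.distrib)
qed

lemma lookup_formal_scale [simp]:
  "Poly_Mapping.lookup (formal_scale a p) xs = a * Poly_Mapping.lookup p xs"
  by (simp add: formal_scale_def Poly_Mapping.map.rep_eq when_def)

lemma lin_formal_scale: "lin g (formal_scale a p) = a *s lin g p"
proof -
  have "lin g (formal_scale a p) =
      (\<Sum>xs\<in>Poly_Mapping.keys p. Poly_Mapping.lookup (formal_scale a p) xs *s g xs)"
    by (rule lin_eq_sum) (auto simp: in_keys_iff)
  then show ?thesis
    by (simp add: lin_def scale_sum_right)
qed

lemma lin_minus: "lin g (- p) = - lin g p"
  using lin_add[of g p "- p"] by (simp add: eq_neg_iff_add_eq_0 add.commute[of _ "lin g p"])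

lemma lin_diff: "lin g (p - q) = lin g p - lin g q"
  using lin_add[of g p "- q"] by (simp add: lin_minus)

lemma lin_sum: "lin g (\<Sum>i\<in>I. P i) = (\<Sum>i\<in>I. lin g (P i))"
  by (induction I rule: infinite_finite_induct) (simp_all add: lin_add)

lemma lin_single [simp]: "lin g (Poly_Mapping.single xs a) = a *s g xs"
  by (simp add: lin_def)

lemma lin_cong: "(\<And>xs. xs \<in> Poly_Mapping.keys p \<Longrightarrow> g xs = h xs) \<Longrightarrow> lin g p = lin h p"
  by (simp add: lin_def)

lemma lin_scale_fun: "lin (\<lambda>xs. a *s g xs) p = a *s lin g p"
  by (simp add: lin_def scale_sum_right mult.commute)

lemma lin_mult_left: "lin (\<lambda>xs. x * g xs) p = x * lin g p"
  by (simp add: lin_def sum_distrib_left scale_mult_right)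

lemma lin_mult_right: "lin (\<lambda>xs. g xs * x) p = lin g p * x"
  by (simp add: lin_def sum_distrib_right scale_mult_left)

lemma lin_sum_fun: "lin (\<lambda>xs. \<Sum>i\<in>I. g i xs) p = (\<Sum>i\<in>I. lin (g i) p)"
  unfolding lin_def by (simp add: scale_sum_right sum.swap[of _ I])

lemma lin_swap: "lin (\<lambda>xs. lin (\<lambda>ys. h xs ys) q) p = lin (\<lambda>ys. lin (\<lambda>xs. h xs ys) p) q"
  unfolding lin_def scale_sum_right
  by (subst sum.swap) (simp add: mult.commute)

lemma lin_reindex:
  "lin g (\<Sum>xs\<in>Poly_Mapping.keys p. Poly_Mapping.single (h xs) (a xs * Poly_Mapping.lookup p xs))
     = lin (\<lambda>xs. a xs *s g (h xs)) p"
  unfolding lin_sum lin_single by (simp add: lin_def mult.commute)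

text \<open>The indicator of one tuple reads off its coefficient, because 1 is nonzero in A.
  Identities of formal sums can thus be checked by computing \<open>lin\<close> on both
  sides.\<close>

lemma formal_eqI:
  assumes "\<And>g. lin g p = lin g q"
  shows "p = q"
proof (rule poly_mapping_eqI)
  fix zs
  have "lin (\<lambda>xs. if xs = zs then 1 else 0) r = Poly_Mapping.lookup r zs *s 1" for r
  proof -
    have "lin (\<lambda>xs. if xs = zs then 1 else 0) r =
        (\<Sum>xs\<in>insert zs (Poly_Mapping.keys r).
           Poly_Mapping.lookup r xs *s (if xs = zs then 1 else 0))"
      by (rule lin_eq_sum) auto
    also have "\<dots> = (\<Sum>xs\<in>insert zs (Poly_Mapping.keys r).
           if xs = zs then Poly_Mapping.lookup r xs *s 1 else 0)"
      by (rule sum.cong) auto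
    finally show ?thesis
      by (simp add: sum.delta)
  qed
  then have "Poly_Mapping.lookup p zs *s (1 :: 'a) = Poly_Mapping.lookup q zs *s 1"
    using assms by metis
  then show "Poly_Mapping.lookup p zs = Poly_Mapping.lookup q zs"
    using scale_cancel_right by auto
qed

sublocale formal: vector_space formal_scale
  by unfold_locales (auto intro!: poly_mapping_eqI simp: lookup_add algebra_simps)

lemma keys_formal_scale: "Poly_Mapping.keys (formal_scale a p) \<subseteq> Poly_Mapping.keys p"
  by (auto simp: in_keys_iff)

lemma formal_scale_single [simp]:
  "formal_scale a (Poly_Mapping.single xs b) = Poly_Mapping.single xs (a * b)"
  by (rule poly_mapping_eqI) (simp add: lookup_single when_def)

lemma formal_subspace: "formal.subspace (formal F n)"
  unfolding formal.subspace_def formal_def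
  by (auto dest!: subsetD[OF Poly_Mapping.keys_add] subsetD[OF keys_formal_scale])

lemmas formal_add = formal.subspace_add[OF formal_subspace]
lemmas formal_diff = formal.subspace_diff[OF formal_subspace]
lemmas formal_sum = formal.subspace_sum[OF formal_subspace]
lemmas formal_zero [simp] = formal.subspace_0[OF formal_subspace]
lemmas formal_scale_closed = formal.subspace_scale[OF formal_subspace]

lemma formal_single: "xs \<in> tuples F n \<Longrightarrow> Poly_Mapping.single xs a \<in> formal F n"
  by (simp add: formal_def)

lemma lin_formal_cong:
  "p \<in> formal F n \<Longrightarrow> (\<And>xs. xs \<in> tuples F n \<Longrightarrow> g xs = h xs) \<Longrightarrow> lin g p = lin h p"
  by (rule lin_cong) (auto simp: formal_def)

lemma formal_sum_keys:
  assumes "p \<in> formal F n" and "\<And>xs. xs \<in> tuples F n \<Longrightarrow> h xs \<in> tuples G m"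
  shows "(\<Sum>xs\<in>Poly_Mapping.keys p. Poly_Mapping.single (h xs) (a xs)) \<in> formal G m"
  using assms(1) by (intro formal_sum formal_single assms(2)) (auto simp: formal_def)

lemma formal_eq_sum_singles:
  "p = (\<Sum>xs\<in>Poly_Mapping.keys p. formal_scale (Poly_Mapping.lookup p xs) (Poly_Mapping.single xs 1))"
proof (rule formal_eqI)
  fix g
  show "lin g p = lin g (\<Sum>xs\<in>Poly_Mapping.keys p.
      formal_scale (Poly_Mapping.lookup p xs) (Poly_Mapping.single xs 1))"
    unfolding lin_sum lin_formal_scale lin_single by (simp add: lin_def)
qed


section \<open>Multilinear maps\<close>

text \<open>The clauses split the tuple in the same way as the generators of
  \<open>tensor_relations\<close>, so that \<open>lin_relations\<close> can match them
  directly.\<close>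

definition multilinear :: "'a set \<Rightarrow> nat \<Rightarrow> ('a list \<Rightarrow> 'a) \<Rightarrow> bool" where
  "multilinear F n g \<longleftrightarrow>
     (\<forall>us x y ws. us @ x # ws \<in> tuples F n \<longrightarrow> y \<in> F \<longrightarrow>
        g (us @ (x + y) # ws) = g (us @ x # ws) + g (us @ y # ws)) \<and>
     (\<forall>us a x ws. us @ x # ws \<in> tuples F n \<longrightarrow>
        g (us @ (a *s x) # ws) = a *s g (us @ x # ws))"

lemma multilinearI:
  assumes "\<And>us x y ws. us @ x # ws \<in> tuples F n \<Longrightarrow> y \<in> F \<Longrightarrow>
        g (us @ (x + y) # ws) = g (us @ x # ws) + g (us @ y # ws)"
    and "\<And>us a x ws. us @ x # ws \<in> tuples F n \<Longrightarrow> g (us @ (a *s x) # ws) = a *s g (us @ x # ws)"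
  shows "multilinear F n g"
  using assms by (simp add: multilinear_def)

lemma multilinear_add:
  "multilinear F n g \<Longrightarrow> us @ x # ws \<in> tuples F n \<Longrightarrow> y \<in> F \<Longrightarrow>
     g (us @ (x + y) # ws) = g (us @ x # ws) + g (us @ y # ws)"
  by (simp add: multilinear_def)

lemma multilinear_scale:
  "multilinear F n g \<Longrightarrow> us @ x # ws \<in> tuples F n \<Longrightarrow> g (us @ (a *s x) # ws) = a *s g (us @ x # ws)"
  by (simp add: multilinear_def)

lemma tuples_2: "xs \<in> tuples F 2 \<longleftrightarrow> (\<exists>x\<in>F. \<exists>y\<in>F. xs = [x, y])"
  by (auto simp: tuples_def length_Suc_conv numeral_2_eq_2)

lemma tuples_3: "xs \<in> tuples F 3 \<longleftrightarrow> (\<exists>x\<in>F. \<exists>y\<in>F. \<exists>z\<in>F. xs = [x, y, z])"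
  by (auto simp: tuples_def length_Suc_conv numeral_3_eq_3)

lemma tuples_4:
  "xs \<in> tuples F 4 \<longleftrightarrow> (\<exists>x\<in>F. \<exists>y\<in>F. \<exists>z\<in>F. \<exists>w\<in>F. xs = [x, y, z, w])"
  by (auto simp: tuples_def length_Suc_conv eval_nat_numeral)

lemma multilinear_2I:
  assumes "\<And>x x' y. x \<in> F \<Longrightarrow> x' \<in> F \<Longrightarrow> y \<in> F \<Longrightarrow> g [x + x', y] = g [x, y] + g [x', y]"
    and "\<And>x y y'. x \<in> F \<Longrightarrow> y \<in> F \<Longrightarrow> y' \<in> F \<Longrightarrow> g [x, y + y'] = g [x, y] + g [x, y']"
    and "\<And>a x y. x \<in> F \<Longrightarrow> y \<in> F \<Longrightarrow> g [a *s x, y] = a *s g [x, y]"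
    and "\<And>a x y. x \<in> F \<Longrightarrow> y \<in> F \<Longrightarrow> g [x, a *s y] = a *s g [x, y]"
  shows "multilinear F 2 g"
proof (rule multilinearI)
  fix us x ws assume "us @ x # ws \<in> tuples F 2"
  then have "x \<in> F \<and> ((us = [] \<and> (\<exists>y\<in>F. ws = [y])) \<or> ((\<exists>y\<in>F. us = [y]) \<and> ws = []))"
    unfolding tuples_2 append_eq_Cons_conv by auto
  then show "y \<in> F \<Longrightarrow> g (us @ (x + y) # ws) = g (us @ x # ws) + g (us @ y # ws)"
    "g (us @ (a *s x) # ws) = a *s g (us @ x # ws)" for y a
    using assms by auto
qed

lemma multilinear_3I:
  assumes "\<And>x x' y z. x \<in> F \<Longrightarrow> x' \<in> F \<Longrightarrow> y \<in> F \<Longrightarrow> z \<in> F \<Longrightarrow>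
      g [x + x', y, z] = g [x, y, z] + g [x', y, z]"
    and "\<And>x y y' z. x \<in> F \<Longrightarrow> y \<in> F \<Longrightarrow> y' \<in> F \<Longrightarrow> z \<in> F \<Longrightarrow>
      g [x, y + y', z] = g [x, y, z] + g [x, y', z]"
    and "\<And>x y z z'. x \<in> F \<Longrightarrow> y \<in> F \<Longrightarrow> z \<in> F \<Longrightarrow> z' \<in> F \<Longrightarrow>
      g [x, y, z + z'] = g [x, y, z] + g [x, y, z']"
    and "\<And>a x y z. x \<in> F \<Longrightarrow> y \<in> F \<Longrightarrow> z \<in> F \<Longrightarrow> g [a *s x, y, z] = a *s g [x, y, z]"
    and "\<And>a x y z. x \<in> F \<Longrightarrow> y \<in> F \<Longrightarrow> z \<in> F \<Longrightarrow> g [x, a *s y, z] = a *s g [x, y, z]"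
    and "\<And>a x y z. x \<in> F \<Longrightarrow> y \<in> F \<Longrightarrow> z \<in> F \<Longrightarrow> g [x, y, a *s z] = a *s g [x, y, z]"
  shows "multilinear F 3 g"
proof (rule multilinearI)
  fix us x ws assume "us @ x # ws \<in> tuples F 3"
  then have "x \<in> F \<and> ((us = [] \<and> (\<exists>y\<in>F. \<exists>z\<in>F. ws = [y, z])) \<or>
      (\<exists>y\<in>F. \<exists>z\<in>F. us = [y] \<and> ws = [z]) \<or> ((\<exists>y\<in>F. \<exists>z\<in>F. us = [y, z]) \<and> ws = []))"
    unfolding tuples_3 append_eq_Cons_conv by auto
  then show "y \<in> F \<Longrightarrow> g (us @ (x + y) # ws) = g (us @ x # ws) + g (us @ y # ws)"
    "g (us @ (a *s x) # ws) = a *s g (us @ x # ws)" for y a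
    using assms by auto
qed

lemma tuples_Suc: "tuples B (Suc n) = (\<lambda>(b, bs). b # bs) ` (B \<times> tuples B n)"
  by (auto simp: tuples_def length_Suc_conv image_iff)

lemma finite_tuples: "finite B \<Longrightarrow> finite (tuples B n)"
  unfolding tuples_def using finite_lists_length_eq[of B n] by (simp add: conj_commute)

text \<open>These are the test maps. Every entry carries a letter behind it, the last one included,
  so that the induction in \<open>word_prod_independent\<close> treats all entries alike.\<close>

definition word_prod :: "'a list \<Rightarrow> 'a list \<Rightarrow> 'a" where
  "word_prod ys xs = prod_list (map2 (*) xs ys)"

lemma word_prod_Cons [simp]: "word_prod (y # ys) (x # xs) = x * y * word_prod ys xs"
  by (simp add: word_prod_def)

lemma word_prod_Nil [simp]: "word_prod [] xs = 1" "word_prod ys [] = 1"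
  by (simp_all add: word_prod_def)

lemma word_prod_multilinear:
  assumes "length ys = n"
  shows "multilinear F n (word_prod ys)"
proof -
  have split: "\<exists>A C. \<forall>x. word_prod ys (us @ x # ws) = A * x * C"
    if len: "length (us @ x # ws) = n" for us x ws
  proof -
    obtain u y w where ys: "ys = u @ y # w" "length u = length us"
    proof
      show "ys = take (length us) ys @ ys ! length us # drop (Suc (length us)) ys"
        "length (take (length us) ys) = length us"
        using len assms by (auto intro!: id_take_nth_drop)
    qed
    have "word_prod ys (us @ x # ws) = prod_list (map2 (*) us u) * x * (y * prod_list (map2 (*) ws w))" for x
      using ys by (simp add: word_prod_def mult.assoc)
    then show ?thesis by blast
  qed
  show ?thesis
  proof (rule multilinearI)
    fix us x y ws assume "us @ x # ws \<in> tuples F n"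
    then obtain A C where "\<forall>x. word_prod ys (us @ x # ws) = A * x * C"
      using split[of us x ws] by (auto simp: tuples_def)
    then show "word_prod ys (us @ (x + y) # ws) = word_prod ys (us @ x # ws) + word_prod ys (us @ y # ws)"
      "\<And>a. word_prod ys (us @ (a *s x) # ws) = a *s word_prod ys (us @ x # ws)"
      by (simp_all add: algebra_simps scale_mult_left scale_mult_right)
  qed
qed

text \<open>Used to let the face maps descend to the quotient: a test map on the larger power pulls
  back to one on the smaller.\<close>

lemma multilinear_insert:
  assumes g: "multilinear F (n + 1) g" and "1 \<in> F" and "i \<le> n"
  shows "multilinear F n (\<lambda>xs. g (take i xs @ 1 # drop i xs))"
proof -
  have split: "\<exists>us' ws'. (\<forall>x. take i (us @ x # ws) @ 1 # drop i (us @ x # ws) = us' @ x # ws') \<and>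
      (\<forall>x\<in>F. us' @ x # ws' \<in> tuples F (n + 1))"
    if "us @ x # ws \<in> tuples F n" for us x ws
  proof (cases "i \<le> length us")
    case True
    then show ?thesis
      using that \<open>1 \<in> F\<close>
      by - (rule exI[of _ "take i us @ 1 # drop i us"], rule exI[of _ ws],
          auto simp: tuples_def dest: in_set_takeD in_set_dropD)
  next
    case False
    \<comment> \<open>Here \<open>x\<close> stands before the inserted 1; writing the offset as
      \<open>Suc j\<close> makes \<open>take\<close> and \<open>drop\<close> pass over
      \<open>x\<close>.\<close>
    then obtain j where j: "i = length us + Suc j"
      by (metis add_Suc_right less_imp_Suc_add not_le)
    then show ?thesis
      using that \<open>1 \<in> F\<close> \<open>i \<le> n\<close>
      by - (rule exI[of _ us], rule exI[of _ "take j ws @ 1 # drop j ws"],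
          auto simp: tuples_def dest: in_set_takeD in_set_dropD)
  qed
  show ?thesis
  proof (rule multilinearI)
    fix us x ws assume a: "us @ x # ws \<in> tuples F n"
    then obtain us' ws' where *:
      "\<And>x. take i (us @ x # ws) @ 1 # drop i (us @ x # ws) = us' @ x # ws'"
      "\<And>x. x \<in> F \<Longrightarrow> us' @ x # ws' \<in> tuples F (n + 1)"
      using split[OF a] by blast
    have x: "x \<in> F" using a by (auto simp: tuples_def)
    show "g (take i (us @ (x + y) # ws) @ 1 # drop i (us @ (x + y) # ws)) =
        g (take i (us @ x # ws) @ 1 # drop i (us @ x # ws)) +
        g (take i (us @ y # ws) @ 1 # drop i (us @ y # ws))" if "y \<in> F" for y
      unfolding * using x that by (intro multilinear_add[OF g] *)
    show "g (take i (us @ (a *s x) # ws) @ 1 # drop i (us @ (a *s x) # ws)) =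
        a *s g (take i (us @ x # ws) @ 1 # drop i (us @ x # ws))" for a
      unfolding * using x by (intro multilinear_scale[OF g] *)
  qed
qed

text \<open>Behind the ideal property of the relations: an entry \<open>x\<close> of the variable
  tuple becomes \<open>z * x\<close>, which is linear in \<open>x\<close>.\<close>

lemma multilinear_map2:
  assumes g: "multilinear F n g" and F: "\<And>x y. x \<in> F \<Longrightarrow> y \<in> F \<Longrightarrow> x * y \<in> F" and zs: "zs \<in> tuples F n"
  shows "multilinear F n (\<lambda>xs. g (map2 (*) zs xs))"
proof -
  have split: "\<exists>us' z ws'. z \<in> F \<and> (\<forall>x. map2 (*) zs (us @ x # ws) = us' @ (z * x) # ws') \<and>
      (\<forall>x\<in>F. us' @ x # ws' \<in> tuples F n)"
    if a: "us @ x # ws \<in> tuples F n" for us x ws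
  proof -
    obtain u z w where z: "zs = u @ z # w" "length u = length us"
    proof
      show "zs = take (length us) zs @ zs ! length us # drop (Suc (length us)) zs"
        "length (take (length us) zs) = length us"
        using a zs by (auto simp: tuples_def intro!: id_take_nth_drop)
    qed
    then have "length w = length ws" using a zs by (simp add: tuples_def)
    with z show ?thesis using a zs
      by - (rule exI[of _ "map2 (*) u us"], rule exI[of _ z], rule exI[of _ "map2 (*) w ws"],
          auto simp: tuples_def elim!: in_set_zipE intro!: F)
  qed
  show ?thesis
  proof (rule multilinearI)
    fix us x ws assume a: "us @ x # ws \<in> tuples F n"
    then obtain us' z ws' where *: "z \<in> F"
      "\<And>x. map2 (*) zs (us @ x # ws) = us' @ (z * x) # ws'"
      "\<And>x. x \<in> F \<Longrightarrow> us' @ x # ws' \<in> tuples F n"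
      using split[OF a] by blast
    have x: "x \<in> F" using a by (auto simp: tuples_def)
    show "g (map2 (*) zs (us @ (x + y) # ws)) =
        g (map2 (*) zs (us @ x # ws)) + g (map2 (*) zs (us @ y # ws))" if "y \<in> F" for y
      unfolding *(2) distrib_left using x that *(1) F by (intro multilinear_add[OF g] *(3)) auto
    show "g (map2 (*) zs (us @ (a *s x) # ws)) = a *s g (map2 (*) zs (us @ x # ws))" for a
      unfolding *(2) scale_mult_right using x *(1) F by (intro multilinear_scale[OF g] *(3)) auto
  qed
qed

section \<open>The multilinearity relations\<close>

text \<open>A multilinear map factors through the tensor power: the zero set of \<open>lin g\<close>
  is a subspace, so the generators suffice.\<close>

lemma lin_relations:
  assumes g: "multilinear F n g" and "p \<in> tensor_relations F n"
  shows "lin g p = 0"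
proof -
  have "formal.subspace {p. lin g p = 0}"
    unfolding formal.subspace_def by (simp add: lin_add lin_formal_scale)
  with assms(2) show ?thesis
    unfolding tensor_relations_def
    by (rule formal.span_induct)
      (auto simp: lin_diff lin_formal_scale multilinear_add[OF g] multilinear_scale[OF g])
qed

lemma relations_subspace: "formal.subspace (tensor_relations F n)"
  unfolding tensor_relations_def by (rule formal.subspace_span)

lemma relations_formal:
  assumes "subspace F"
  shows "tensor_relations F n \<subseteq> formal F n"
  unfolding tensor_relations_def
  by (rule formal.span_minimal[OF _ formal_subspace])
    (use assms in \<open>auto intro!: formal_diff formal_single formal_scale_closed
      simp: tuples_def subspace_add subspace_scale\<close>)

lemma relation_add:
  "us @ x # ws \<in> tuples F n \<Longrightarrow> y \<in> F \<Longrightarrow>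
   Poly_Mapping.single (us @ (x + y) # ws) 1
     - Poly_Mapping.single (us @ x # ws) 1 - Poly_Mapping.single (us @ y # ws) 1
   \<in> tensor_relations F n"
  unfolding tensor_relations_def by (rule formal.span_base) blast

lemma relation_scale:
  "us @ x # ws \<in> tuples F n \<Longrightarrow>
   Poly_Mapping.single (us @ (a *s x) # ws) 1
     - formal_scale a (Poly_Mapping.single (us @ x # ws) 1) \<in> tensor_relations F n"
  unfolding tensor_relations_def by (rule formal.span_base) blast

text \<open>The entries are expanded one at a time: \<open>us\<close> already consists of elements
  of \<open>B\<close>, \<open>xs\<close> is still to be treated. The inner span induction expands
  the current entry; the outer hypothesis is used with one element of \<open>B\<close> appended to
  \<open>us\<close>.\<close>

lemma relations_basis_tuples_aux:
  assumes B: "B \<subseteq> F" "span B = F" "finite B"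
  shows "us \<in> lists B \<Longrightarrow> xs \<in> lists F \<Longrightarrow> length us + length xs = n \<Longrightarrow>
    \<exists>q \<in> formal.span ((\<lambda>xs. Poly_Mapping.single xs 1) ` tuples B n).
      Poly_Mapping.single (us @ xs) 1 - q \<in> tensor_relations F n"
proof (induction xs arbitrary: us)
  case Nil
  then show ?case
    by (intro bexI[of _ "Poly_Mapping.single us 1"])
      (auto intro!: formal.span_base formal.subspace_0 relations_subspace simp: tuples_def)
next
  case (Cons x xs)
  let ?S = "formal.span ((\<lambda>xs. Poly_Mapping.single xs 1) ` tuples B n)"
  let ?R = "tensor_relations F n"
  have F: "subspace F" using B by (metis subspace_span)
  have "x \<in> span B" using Cons.prems B by auto
  \<comment> \<open>Membership in \<open>F\<close> is carried along because
    \<open>relation_add\<close> asks for it of the remaining summand \<open>y\<close>.\<close>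
  then have "x \<in> F \<and> (\<exists>q\<in>?S. Poly_Mapping.single (us @ x # xs) 1 - q \<in> ?R)"
  proof (induction rule: span_induct_alt)
    case base
    have t: "us @ 0 # xs \<in> tuples F n"
      using Cons.prems B subspace_0[OF F] by (auto simp: tuples_def lists_eq_set)
    from relation_scale[OF this, of 0]
    show ?case
      using subspace_0[OF F] by (intro conjI bexI[of _ 0]) (auto intro: formal.span_zero)
  next
    case (step a b y)
    then obtain q where q: "q \<in> ?S" "Poly_Mapping.single (us @ y # xs) 1 - q \<in> ?R"
      and y: "y \<in> F" by blast
    have "us @ [b] \<in> lists B" using Cons.prems step by auto
    with Cons.IH[of "us @ [b]"] Cons.prems obtain r where
      r: "r \<in> ?S" "Poly_Mapping.single (us @ b # xs) 1 - r \<in> ?R" by auto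
    have b: "b \<in> F" using step B by auto
    have ty: "us @ (a *s b) # xs \<in> tuples F n" "us @ b # xs \<in> tuples F n"
      using Cons.prems B b subspace_scale[OF F] by (auto simp: tuples_def lists_eq_set)
    have "Poly_Mapping.single (us @ (a *s b + y) # xs) 1 - (formal_scale a r + q) =
        (Poly_Mapping.single (us @ (a *s b + y) # xs) 1
          - Poly_Mapping.single (us @ (a *s b) # xs) 1 - Poly_Mapping.single (us @ y # xs) 1)
        + (Poly_Mapping.single (us @ (a *s b) # xs) 1
             - formal_scale a (Poly_Mapping.single (us @ b # xs) 1))
        + formal_scale a (Poly_Mapping.single (us @ b # xs) 1 - r)
        + (Poly_Mapping.single (us @ y # xs) 1 - q)"
      unfolding formal.scale_right_diff_distrib by simp
    also have "\<dots> \<in> ?R"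
      by (intro formal.subspace_add[OF relations_subspace] formal.subspace_scale[OF relations_subspace]
          relation_add relation_scale ty y q r)
    finally show ?case
      using q r y b by (intro conjI bexI[of _ "formal_scale a r + q"] formal.span_add formal.span_scale
          subspace_add[OF F] subspace_scale[OF F])
  qed
  then show ?case by blast
qed

lemma relations_basis_tuples:
  assumes B: "B \<subseteq> F" "span B = F" "finite B" and p: "p \<in> formal F n"
  obtains q where "q \<in> formal.span ((\<lambda>xs. Poly_Mapping.single xs 1) ` tuples B n)"
    "p - q \<in> tensor_relations F n"
proof -
  let ?S = "formal.span ((\<lambda>xs. Poly_Mapping.single xs 1) ` tuples B n)"
  have "\<exists>q\<in>?S. Poly_Mapping.single xs 1 - q \<in> tensor_relations F n"
    if "xs \<in> Poly_Mapping.keys p" for xs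
    using relations_basis_tuples_aux[OF B, of "[]" xs n] that p
    by (auto simp: formal_def tuples_def lists_eq_set)
  then obtain Q where Q: "\<And>xs. xs \<in> Poly_Mapping.keys p \<Longrightarrow> Q xs \<in> ?S"
    "\<And>xs. xs \<in> Poly_Mapping.keys p \<Longrightarrow> Poly_Mapping.single xs 1 - Q xs \<in> tensor_relations F n"
    by metis
  let ?q = "\<Sum>xs\<in>Poly_Mapping.keys p. formal_scale (Poly_Mapping.lookup p xs) (Q xs)"
  have "p - ?q = (\<Sum>xs\<in>Poly_Mapping.keys p.
      formal_scale (Poly_Mapping.lookup p xs) (Poly_Mapping.single xs 1 - Q xs))"
    unfolding formal.scale_right_diff_distrib sum_subtractf
    by (subst (1) formal_eq_sum_singles) simp
  also have "\<dots> \<in> tensor_relations F n"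
    by (intro formal.subspace_sum[OF relations_subspace] formal.subspace_scale[OF relations_subspace] Q)
  finally show ?thesis
    using Q(1) by (intro that[of ?q]) (auto intro!: formal.span_sum formal.span_scale)
qed

end

section \<open>Linear independence of words in a central simple algebra\<close>

context central_simple_algebra
begin

text \<open>The values at \<open>c\<close> of all solution families form a two-sided ideal. If it is
  zero, \<open>c\<close> drops out and induction applies. Otherwise some solution \<open>u\<close>
  has \<open>u c = 1\<close>; its commutators with any \<open>z\<close> are solutions vanishing at
  \<open>c\<close>, hence zero by induction. So \<open>u\<close> takes scalar values, and
  \<open>y = 1\<close> gives a linear relation on \<open>B\<close> in which \<open>c\<close> has
  coefficient 1.\<close>

lemma independent_coefficients_zero:
  assumes "finite B" "independent B" "\<And>y. (\<Sum>b\<in>B. b * y * w b) = 0" "b \<in> B"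
  shows "w b = 0"
  using assms
proof (induction B arbitrary: w b rule: finite_induct)
  case (insert c B)
  define W where "W = {w. \<forall>y. (\<Sum>b\<in>insert c B. b * y * w b) = 0}"
  have IH: "w b = 0" if "w \<in> W" "w c = 0" "b \<in> insert c B" for w b
  proof (cases "b = c")
    case False
    have "(\<Sum>b\<in>B. b * y * w b) = 0" for y
      using that insert.hyps by (simp add: W_def)
    with False that show ?thesis
      using insert.IH[of w b] independent_mono[OF insert.prems(1)] by auto
  qed (use that in simp)
  have "two_sided_ideal ((\<lambda>w. w c) ` W)"
    unfolding two_sided_ideal_def
  proof (intro conjI ballI allI)
    show "0 \<in> (\<lambda>w. w c) ` W"
      by (rule image_eqI[of _ _ "\<lambda>_. 0"]) (simp_all add: W_def)
  next
    fix u v assume "u \<in> (\<lambda>w. w c) ` W" "v \<in> (\<lambda>w. w c) ` W"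
    then obtain w w' where "w \<in> W" "w' \<in> W" "u = w c" "v = w' c" by blast
    then show "u + v \<in> (\<lambda>w. w c) ` W"
      by (intro image_eqI[of _ _ "\<lambda>b. w b + w' b"])
        (simp_all del: sum.insert add: W_def distrib_left sum.distrib)
  next
    fix u r assume "u \<in> (\<lambda>w. w c) ` W"
    then obtain w where w: "w \<in> W" "u = w c" by blast
    \<comment> \<open>Left multiplication by \<open>r\<close> is absorbed by replacing
      \<open>y\<close> with \<open>y * r\<close>.\<close>
    have "(\<lambda>b. r * w b) \<in> W"
      unfolding W_def
    proof (intro CollectI allI)
      fix y
      show "(\<Sum>b\<in>insert c B. b * y * (r * w b)) = 0"
        using w(1)[unfolded W_def, THEN CollectD, THEN spec, of "y * r"]
        by (simp only: mult.assoc)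
    qed
    then show "r * u \<in> (\<lambda>w. w c) ` W"
      using w by (intro image_eqI[of _ _ "\<lambda>b. r * w b"]) simp_all
    have "(\<lambda>b. w b * r) \<in> W"
      using w unfolding W_def
      by (simp del: sum.insert add: mult.assoc[symmetric] sum_distrib_right[symmetric])
    then show "u * r \<in> (\<lambda>w. w c) ` W"
      using w by (intro image_eqI[of _ _ "\<lambda>b. w b * r"]) simp_all
  qed
  then consider "(\<lambda>w. w c) ` W = {0}" | "(\<lambda>w. w c) ` W = UNIV"
    using simple by blast
  then show ?case
  proof cases
    case 1
    have "w \<in> W" using insert.prems by (simp add: W_def)
    with 1 show ?thesis using IH insert.prems by blast
  next
    case 2
    then have "1 \<in> (\<lambda>w. w c) ` W" by blast
    then obtain u where u: "u \<in> W" "u c = 1" by auto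
    have "\<exists>a. u b = a *s 1" if b: "b \<in> insert c B" for b
    proof -
      have "u b * z = z * u b" for z
      proof -
        have "(\<lambda>b. u b * z - z * u b) \<in> W"
          unfolding W_def
        proof (intro CollectI allI)
          fix y
          have "(\<Sum>b\<in>insert c B. b * y * (u b * z - z * u b)) =
              (\<Sum>b\<in>insert c B. b * y * u b) * z - (\<Sum>b\<in>insert c B. b * (y * z) * u b)"
            by (simp only: right_diff_distrib sum_subtractf sum_distrib_right mult.assoc)
          then show "(\<Sum>b\<in>insert c B. b * y * (u b * z - z * u b)) = 0"
            using u(1) by (simp del: sum.insert add: W_def)
        qed
        from IH[OF this _ b] u show ?thesis by simp
      qed
      then have "u b \<in> {z. \<forall>x. z * x = x * z}" by simp
      then show ?thesis unfolding center by blast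
    qed
    then obtain a where a: "\<And>b. b \<in> insert c B \<Longrightarrow> u b = a b *s 1"
      by metis
    have "(\<Sum>b\<in>insert c B. b * 1 * u b) = (\<Sum>b\<in>insert c B. a b *s b)"
      by (intro sum.cong refl) (simp add: a scale_mult_right)
    then have "(\<Sum>b\<in>insert c B. a b *s b) = 0"
      using u(1)[unfolded W_def, THEN CollectD, THEN spec, of 1] by simp
    then have "a c = 0"
      using independentD[OF insert.prems(1), of "insert c B" a c] insert.hyps by simp
    then have "u c = 0" using a by simp
    then show ?thesis using u by simp
  qed
qed simp

text \<open>Terms are collected by their first entry \<open>b\<close>. The coefficients behind
  \<open>b * y\<close> are words in the remaining entries; each vanishes by the previous lemma, as
  \<open>y\<close> is arbitrary.\<close>

lemma word_prod_independent:
  assumes B: "finite B" "independent B"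
    and "\<And>ys. length ys = n \<Longrightarrow> (\<Sum>bs\<in>tuples B n. a bs *s word_prod ys bs) = 0"
    and "bs \<in> tuples B n"
  shows "a bs = 0"
  using assms(3,4)
proof (induction n arbitrary: a bs)
  case 0
  from "0.prems"(1)[of "[]"] "0.prems"(2) show ?case
    by (simp add: tuples_def cong: conj_cong)
next
  case (Suc n)
  obtain b cs where bs: "bs = b # cs" "b \<in> B" "cs \<in> tuples B n"
    using Suc.prems(2) by (auto simp: tuples_Suc)
  have "(\<Sum>cs\<in>tuples B n. a (b # cs) *s word_prod ys cs) = 0" if "length ys = n" for ys
  proof -
    have "(\<Sum>b\<in>B. b * y * (\<Sum>cs\<in>tuples B n. a (b # cs) *s word_prod ys cs)) = 0" for y
    proof -
      have "(\<Sum>b\<in>B. b * y * (\<Sum>cs\<in>tuples B n. a (b # cs) *s word_prod ys cs)) =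
          (\<Sum>bs\<in>tuples B (Suc n). a bs *s word_prod (y # ys) bs)"
        unfolding tuples_Suc
        by (subst sum.reindex)
          (auto simp: inj_on_def sum.cartesian_product sum_distrib_left scale_mult_right
            split_def)
      with Suc.prems(1)[of "y # ys"] that show ?thesis by simp
    qed
    from independent_coefficients_zero[OF B this bs(2)] show ?thesis .
  qed
  from Suc.IH[OF this bs(3)] bs show ?case by simp
qed

end

section \<open>A commutative subalgebra: its basis, its trace, and the relations tested by
  words\<close>

locale commutative_in_csa = central_simple_algebra scale
  for scale :: "'k::field \<Rightarrow> 'a::ring_1 \<Rightarrow> 'a" (infixr "*s" 75) +
  fixes F :: "'a set"
  assumes F: "comm_subalgebra F"
begin

lemma F_subspace: "subspace F"
  using F by (simp add: comm_subalgebra_def subalgebra_def)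

lemma F_one [simp]: "1 \<in> F"
  using F by (simp add: comm_subalgebra_def subalgebra_def)

lemma F_mult [simp]: "x \<in> F \<Longrightarrow> y \<in> F \<Longrightarrow> x * y \<in> F"
  using F by (simp add: comm_subalgebra_def subalgebra_def)

lemma F_commute: "x \<in> F \<Longrightarrow> y \<in> F \<Longrightarrow> x * y = y * x"
  using F by (simp add: comm_subalgebra_def)

lemmas F_add [simp] = subspace_add[OF F_subspace]
lemmas F_scale [simp] = subspace_scale[OF F_subspace]
lemmas F_diff [simp] = subspace_diff[OF F_subspace]
lemmas F_zero [simp] = subspace_0[OF F_subspace]

text \<open>The \<open>SOME\<close> term is the one inside \<open>Tr\<close>, which makes
  \<open>Tr_eq\<close> a mere unfolding.\<close>

definition basis :: "'a set" where
  "basis = (SOME B. B \<subseteq> F \<and> independent B \<and> span B = F)"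

lemma basis: "basis \<subseteq> F" "independent basis" "span basis = F"
proof -
  obtain B where "B \<subseteq> F" "independent B" "F \<subseteq> span B"
    by (rule maximal_independent_subset)
  then have "\<exists>B. B \<subseteq> F \<and> independent B \<and> span B = F"
    using span_minimal[OF _ F_subspace] by blast
  from someI_ex[OF this] show "basis \<subseteq> F" "independent basis" "span basis = F"
    unfolding basis_def by auto
qed

lemma finite_basis: "finite basis"
proof -
  obtain C where "finite C" "span C = UNIV" using finite_dim by blast
  then show ?thesis
    using independent_span_bound[of C basis] basis by simp
qed

lemma basis_F [simp]: "b \<in> basis \<Longrightarrow> b \<in> F"
  using basis by auto

lemma basis_coord_add:
  "x \<in> F \<Longrightarrow> y \<in> F \<Longrightarrow> representation basis (x + y) b = representation basis x b + representation basis y b"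
  by (simp add: representation_add basis)

lemma basis_coord_scale:
  "x \<in> F \<Longrightarrow> representation basis (a *s x) b = a * representation basis x b"
  by (simp add: representation_scale basis)

lemma basis_expand: "x \<in> F \<Longrightarrow> (\<Sum>b\<in>basis. representation basis x b *s b) = x"
  using sum_representation_eq[of basis x basis] basis finite_basis by simp

lemma Tr_eq: "Tr F x = (\<Sum>b\<in>basis. representation basis (x * b) b)"
  by (simp add: Tr_def basis_def Let_def)

lemma Tr_add: "x \<in> F \<Longrightarrow> y \<in> F \<Longrightarrow> Tr F (x + y) = Tr F x + Tr F y"
  by (simp add: Tr_eq distrib_right basis_coord_add sum.distrib)

lemma Tr_scale: "x \<in> F \<Longrightarrow> Tr F (a *s x) = a * Tr F x"
  by (simp add: Tr_eq scale_mult_left basis_coord_scale sum_distrib_left)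

text \<open>Basis tuples form a basis of the tensor power; this is the independence half, read off
  from words. The spanning half is \<open>relations_basis_tuples\<close>.\<close>

lemma singles_independent:
  assumes "(\<Sum>bs\<in>tuples basis n. formal_scale (a bs) (Poly_Mapping.single bs 1)) \<in> tensor_relations F n"
    and "bs \<in> tuples basis n"
  shows "a bs = 0"
proof (rule word_prod_independent[OF finite_basis basis(2) _ assms(2)])
  fix ys :: "'a list" assume "length ys = n"
  from lin_relations[OF word_prod_multilinear[OF this] assms(1)]
  show "(\<Sum>bs\<in>tuples basis n. a bs *s word_prod ys bs) = 0"
    unfolding lin_sum by simp
qed

text \<open>This is the injectivity of \<open>A \<otimes> A\<^sup>o\<^sup>p \<rightarrow> End A\<close>, iterated.\<close>

lemma relations_iff:
  "p \<in> tensor_relations F n \<longleftrightarrow>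
     p \<in> formal F n \<and> (\<forall>ys. length ys = n \<longrightarrow> lin (word_prod ys) p = 0)"
  (is "_ \<longleftrightarrow> ?rhs")
proof
  assume "p \<in> tensor_relations F n"
  then show ?rhs
    using relations_formal[OF F_subspace] lin_relations[OF word_prod_multilinear] by blast
next
  assume p: ?rhs
  \<comment> \<open>Modulo relations \<open>p\<close> becomes a combination \<open>q\<close> of
    basis tuples. Relations have zero words, so the words of \<open>q\<close> vanish too, and
    independence kills its coefficients.\<close>
  obtain q where q: "q \<in> formal.span ((\<lambda>xs. Poly_Mapping.single xs 1) ` tuples basis n)"
    "p - q \<in> tensor_relations F n"
    using relations_basis_tuples[OF basis(1,3) finite_basis, of p n] p by blast
  have "\<exists>a. q = (\<Sum>bs\<in>tuples basis n. formal_scale (a bs) (Poly_Mapping.single bs 1))"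
  proof -
    have inj: "inj_on (\<lambda>xs. Poly_Mapping.single xs (1 :: 'k)) (tuples basis n)"
      by (auto intro!: inj_onI dest: arg_cong[of _ _ Poly_Mapping.keys])
    from q(1) obtain u where
      "q = (\<Sum>v\<in>(\<lambda>xs. Poly_Mapping.single xs 1) ` tuples basis n. formal_scale (u v) v)"
      using formal.span_finite[OF finite_imageI[OF finite_tuples[OF finite_basis]]] by auto
    then show ?thesis
      by (subst (asm) sum.reindex[OF inj]) (auto simp: o_def)
  qed
  then obtain a where a: "q = (\<Sum>bs\<in>tuples basis n. formal_scale (a bs) (Poly_Mapping.single bs 1))"
    by blast
  have "a bs = 0" if "bs \<in> tuples basis n" for bs
  proof (rule word_prod_independent[OF finite_basis basis(2) _ that])
    fix ys :: "'a list" assume ys: "length ys = n"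
    have "lin (word_prod ys) (p - q) = 0"
      by (rule lin_relations[OF word_prod_multilinear[OF ys] q(2)])
    then have "lin (word_prod ys) q = 0"
      using p ys by (simp add: lin_diff)
    then show "(\<Sum>bs\<in>tuples basis n. a bs *s word_prod ys bs) = 0"
      unfolding a lin_sum by simp
  qed
  then have "q = 0" unfolding a by simp
  with q show "p \<in> tensor_relations F n" by simp
qed

end

section \<open>Separability\<close>

context k_algebra
begin

text \<open>Evaluation inside the factor with unit \<open>e\<close>, where the zeroth power of
  \<open>x\<close> is \<open>e\<close>; the sum is the one in
  \<open>factor_separable\<close>.\<close>

definition peval :: "'a \<Rightarrow> 'a \<Rightarrow> 'k poly \<Rightarrow> 'a" where
  "peval e x p = (\<Sum>i\<le>Polynomial.degree p. coeff p i *s (x ^ i * e))"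

lemma peval_eq_sum:
  assumes "Polynomial.degree p \<le> n"
  shows "peval e x p = (\<Sum>i\<le>n. coeff p i *s (x ^ i * e))"
  unfolding peval_def using assms
  by (intro sum.mono_neutral_left) (auto simp: coeff_eq_0)

lemma peval_0 [simp]: "peval e x 0 = 0"
  by (simp add: peval_def)

lemma peval_pCons [simp]: "peval e x (pCons a p) = a *s e + x * peval e x p"
proof -
  have "peval e x (pCons a p) = (\<Sum>i\<le>Suc (Polynomial.degree p). coeff (pCons a p) i *s (x ^ i * e))"
    by (rule peval_eq_sum) (rule degree_pCons_le)
  then show ?thesis
    by (simp only: sum.atMost_Suc_shift)
      (simp add: peval_def sum_distrib_left scale_mult_right mult.assoc)
qed

lemma peval_add: "peval e x (p + q) = peval e x p + peval e x q"
proof -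
  let ?n = "max (Polynomial.degree p) (Polynomial.degree q)"
  have "peval e x (p + q) = (\<Sum>i\<le>?n. coeff (p + q) i *s (x ^ i * e))"
    by (rule peval_eq_sum) (rule degree_add_le_max)
  moreover have "peval e x p = (\<Sum>i\<le>?n. coeff p i *s (x ^ i * e))"
    "peval e x q = (\<Sum>i\<le>?n. coeff q i *s (x ^ i * e))"
    by (rule peval_eq_sum; simp)+
  ultimately show ?thesis
    by (simp add: scale_left_distrib sum.distrib)
qed

lemma peval_smult: "peval e x (Polynomial.smult a p) = a *s peval e x p"
  by (induction p) (simp_all add: scale_right_distrib scale_mult_right)

lemma peval_mult:
  assumes "e * e = e" "x * e = x" "e * x = x"
  shows "peval e x (p * q) = peval e x p * peval e x q"
proof -
  have e: "e * peval e x q = peval e x q" for q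
    using assms by (induction q) (simp_all add: distrib_left scale_mult_right mult.assoc[symmetric])
  show ?thesis
    by (induction p)
      (simp_all add: peval_add peval_smult e distrib_right scale_mult_left mult.assoc)
qed

text \<open>A nonzero annihilating polynomial of least degree divides every annihilating one, by
  division with remainder. If it divided both \<open>p\<close> and its derivative, it would be a
  constant \<open>c\<close> with \<open>c *s e = 0\<close>.\<close>

lemma peval_pderiv_nonzero:
  assumes e: "e * e = e" "x * e = x" "e * x = x" "e \<noteq> 0"
    and p: "p \<noteq> 0" "coprime p (pderiv p)" "peval e x p = 0"
  shows "peval e x (pderiv p) \<noteq> 0"
proof
  assume p': "peval e x (pderiv p) = 0"
  define J where "J = {q. q \<noteq> 0 \<and> peval e x q = 0}"
  have "p \<in> J" using p by (simp add: J_def)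
  from arg_min_natI[of "\<lambda>q. q \<in> J", OF this, of Polynomial.degree]
    arg_min_nat_le[of "\<lambda>q. q \<in> J" _ Polynomial.degree]
  obtain g where g: "g \<in> J" "\<And>q. q \<in> J \<Longrightarrow> Polynomial.degree g \<le> Polynomial.degree q"
    by metis
  have "g dvd q" if "peval e x q = 0" for q
  proof (rule ccontr)
    assume "\<not> g dvd q"
    then have nz: "q mod g \<noteq> 0" by (simp add: dvd_eq_mod_eq_0)
    have "peval e x (q div g * g + q mod g) = peval e x (q mod g)"
      using g(1) by (simp only: peval_add peval_mult[OF e(1-3)]) (simp add: J_def)
    then have "q mod g \<in> J" using that nz by (simp add: J_def)
    moreover have "Polynomial.degree (q mod g) < Polynomial.degree g"
      using degree_mod_less'[OF _ nz] g(1) by (simp add: J_def)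
    ultimately show False using g(2) by (meson not_le)
  qed
  then have "is_unit g" using p p' by (meson coprime_common_divisor)
  then obtain c where c: "g = [:c:]" by (auto simp: is_unit_poly_iff)
  with g(1) have "c *s e = 0" "c \<noteq> 0" by (auto simp: J_def)
  with e(4) show False by simp
qed

end

section \<open>Operators from F \<otimes> F on A and Taylor's formula\<close>

context commutative_in_csa
begin

lemma F_left_commute: "x \<in> F \<Longrightarrow> y \<in> F \<Longrightarrow> x * (y * z) = y * (x * z)"
  by (simp add: mult.assoc[symmetric] F_commute)

text \<open>The image of F \<otimes> F in the endomorphisms of A. It is closed under left and right
  multiplication by F, so commutators with elements of F can be formed without handling
  tensors.\<close>

inductive_set ops :: "('a \<Rightarrow> 'a) set" where
  sandwich: "x \<in> F \<Longrightarrow> y \<in> F \<Longrightarrow> (\<lambda>z. x * z * y) \<in> ops"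
| add: "S \<in> ops \<Longrightarrow> T \<in> ops \<Longrightarrow> (\<lambda>z. S z + T z) \<in> ops"

lemma ops_left: "T \<in> ops \<Longrightarrow> x \<in> F \<Longrightarrow> (\<lambda>z. x * T z) \<in> ops"
proof (induction rule: ops.induct)
  case (sandwich u y)
  then show ?case using ops.sandwich[of "x * u" y] by (simp add: mult.assoc)
qed (simp add: distrib_left ops.add)

lemma ops_right: "T \<in> ops \<Longrightarrow> x \<in> F \<Longrightarrow> (\<lambda>z. T z * x) \<in> ops"
proof (induction rule: ops.induct)
  case (sandwich u y)
  then show ?case using ops.sandwich[of u "y * x"] by (simp add: mult.assoc)
qed (simp add: distrib_right ops.add)

lemma ops_comp: "S \<in> ops \<Longrightarrow> T \<in> ops \<Longrightarrow> (\<lambda>z. S (T z)) \<in> ops"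
  by (induction rule: ops.induct) (auto intro: ops_left ops_right ops.add)

lemma ops_id: "(\<lambda>z. z) \<in> ops"
  using ops.sandwich[of 1 1] by simp

lemma ops_zero: "(\<lambda>z. 0) \<in> ops"
  using ops.sandwich[of 0 0] by simp

lemma ops_diff: "S \<in> ops \<Longrightarrow> T \<in> ops \<Longrightarrow> (\<lambda>z. S z - T z) \<in> ops"
  using ops.add[of S "\<lambda>z. - 1 * T z"] ops_left[of T "- 1"] F_diff[of 0 1] by simp

lemma ops_sum: "(\<And>i. i \<in> I \<Longrightarrow> T i \<in> ops) \<Longrightarrow> (\<lambda>z. \<Sum>i\<in>I. T i z) \<in> ops"
  by (induction I rule: infinite_finite_induct) (auto intro: ops_zero ops.add)

lemma ops_linear:
  assumes "T \<in> ops"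
  shows "T (z - w) = T z - T w" "x \<in> F \<Longrightarrow> T (x * z) = x * T z" "x \<in> F \<Longrightarrow> T (z * x) = T z * x"
  using assms
proof (induction rule: ops.induct)
  case (sandwich u y)
  {
    case 1
    then show ?case by (simp add: algebra_simps)
  next
    case 2
    then show ?case using sandwich F_commute[of u x] by (simp add: mult.assoc[symmetric])
  next
    case 3
    then show ?case using sandwich F_commute[of y x] by (simp add: mult.assoc)
  }
qed (simp_all add: distrib_left distrib_right)

text \<open>The value at 1 is the image of an underlying tensor under the multiplication of
  F.\<close>

lemma ops_one: "T \<in> ops \<Longrightarrow> T 1 \<in> F"
  by (induction rule: ops.induct) simp_all

lemma peval_F: "e \<in> F \<Longrightarrow> x \<in> F \<Longrightarrow> peval e x p \<in> F"
  by (induction p) simp_all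

text \<open>With L and R the left and right multiplications by \<open>x\<close>, this is Taylor's
  formula q(L) - q(R) = (L - R) q'(R) + (L - R)^2 r. The constant term of \<open>q\<close> evaluates
  to a multiple of \<open>e\<close>, so it cancels on those \<open>w\<close> that commute with
  \<open>e\<close>.\<close>

lemma commutator_peval:
  assumes "e \<in> F" "x \<in> F"
  shows "\<exists>r\<in>ops. \<forall>w. e * w = w * e \<longrightarrow>
    peval e x q * w - w * peval e x q = (x * w - w * x) * peval e x (pderiv q)
      + (x * (x * r w - r w * x) - (x * r w - r w * x) * x)"
proof (induction q)
  case 0
  then show ?case by (intro bexI[OF _ ops_zero]) simp
next
  case (pCons a q)
  define Q where "Q = peval e x q"
  define D where "D = peval e x (pderiv q)"
  obtain r where r: "r \<in> ops" "\<And>w. e * w = w * e \<Longrightarrow> Q * w - w * Q = (x * w - w * x) * D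
      + (x * (x * r w - r w * x) - (x * r w - r w * x) * x)"
    using pCons.IH unfolding Q_def D_def by blast
  have D: "D * x = x * D" "D * (x * z) = x * (D * z)" for z
    using assms F_commute[of D x] peval_F unfolding D_def by (simp_all add: mult.assoc[symmetric])
  have Q: "Q * x = x * Q" "Q * (x * z) = x * (Q * z)" for z
    using assms F_commute[of Q x] peval_F unfolding Q_def by (simp_all add: mult.assoc[symmetric])
  \<comment> \<open>Moving \<open>x\<close> past the commutator of \<open>x\<close> and
    \<open>w\<close> costs a double commutator of \<open>w * D\<close>; this gives the new
    remainder.\<close>
  have "(a *s e + x * Q) * w - w * (a *s e + x * Q) = (x * w - w * x) * (Q + x * D)
      + (x * (x * (w * D + x * r w) - (w * D + x * r w) * x)
           - (x * (w * D + x * r w) - (w * D + x * r w) * x) * x)"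
    if w: "e * w = w * e" for w
  proof -
    have "(a *s e + x * Q) * w - w * (a *s e + x * Q) = x * (Q * w - w * Q) + (x * w - w * x) * Q"
      using w by (simp add: algebra_simps scale_mult_left scale_mult_right)
    also have "\<dots> = (x * w - w * x) * (Q + x * D)
      + (x * (x * (w * D + x * r w) - (w * D + x * r w) * x)
           - (x * (w * D + x * r w) - (w * D + x * r w) * x) * x)"
      unfolding r(2)[OF w]
      by (simp only: distrib_left distrib_right right_diff_distrib left_diff_distrib mult.assoc D) simp
    finally show ?thesis .
  qed
  moreover have "(\<lambda>w. w * D + x * r w) \<in> ops"
    using assms r peval_F unfolding D_def by (intro ops.add ops_left ops_right ops_id) auto
  ultimately show ?case
    by (intro bexI[of _ "\<lambda>w. w * D + x * r w"])
      (simp_all add: pderiv_pCons peval_add Q_def D_def)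
qed

text \<open>If \<open>s\<close> commutes with the unit \<open>e\<close> of the factor containing \<open>x\<close>, then Taylor's formula
  writes the commutator of \<open>x\<close> with \<open>s z\<close> as a double commutator, so a correction of \<open>s\<close> by a
  commutator makes it commute with \<open>x\<close>.\<close>

lemma separability_step:
  assumes s: "s \<in> ops" "s 1 = 1" "\<And>z. e * s z = s z * e"
    and e: "e \<in> F" "e * e = e" and x: "x \<in> F" "x * e = x"
    and p: "peval e x p = 0" and y: "y \<in> F" "peval e x (pderiv p) * y = e"
  shows "\<exists>s'\<in>ops. s' 1 = 1 \<and> (\<forall>z. x * s' z = s' z * x) \<and>
    (\<forall>f\<in>F. (\<forall>z. f * s z = s z * f) \<longrightarrow> (\<forall>z. f * s' z = s' z * f))"
proof -
  obtain r where r: "r \<in> ops" "\<And>w. e * w = w * e \<Longrightarrow> peval e x p * w - w * peval e x p =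
      (x * w - w * x) * peval e x (pderiv p) + (x * (x * r w - r w * x) - (x * r w - r w * x) * x)"
    using commutator_peval[OF e(1) x(1), of p] by blast
  \<comment> \<open>Taylor's formula for \<open>p\<close>, multiplied by the inverse
    \<open>y\<close> of p'(x), reads [x, w] + [x, [x, r(w) y]] = 0 for \<open>w\<close> commuting
    with \<open>e\<close>. This says [x, T w] = 0.\<close>
  define T where "T w = w + (x * (r w * y) - (r w * y) * x)" for w
  have T: "T \<in> ops"
    unfolding T_def using r x y by (intro ops.add ops_diff ops_left ops_right ops_id) auto
  define s' where "s' z = T (s z)" for z
  have s': "s' \<in> ops"
    unfolding s'_def by (rule ops_comp[OF T s(1)])
  \<comment> \<open>Both \<open>x\<close> and \<open>r 1 * y\<close> lie in the commutative F, so
    the correcting commutator vanishes at 1.\<close>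
  have one: "s' 1 = 1"
    using F_commute[of x "r 1 * y"] x y ops_one[OF r(1)] by (simp add: s'_def T_def s)
  have "x * T w = T w * x" if w: "e * w = w * e" for w
  proof -
    have xy: "y * x = x * y" "\<And>z. y * (x * z) = x * (y * z)"
      using F_commute[of x y] x y by (simp_all add: mult.assoc[symmetric])
    have "0 = ((x * w - w * x) * peval e x (pderiv p)
        + (x * (x * r w - r w * x) - (x * r w - r w * x) * x)) * y"
      using r(2)[OF w] p by simp
    also have "\<dots> = (x * w - w * x) * (peval e x (pderiv p) * y)
        + (x * (x * (r w * y) - (r w * y) * x) - (x * (r w * y) - (r w * y) * x) * x)"
      by (simp add: algebra_simps xy)
    also note y(2)
    also have "(x * w - w * x) * e = x * (w * e) - w * (x * e)"
      by (simp add: algebra_simps)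
    also have "\<dots> = x * w - w * x"
      unfolding w[symmetric] x(2) by (simp add: mult.assoc[symmetric] x(2))
    finally show ?thesis
      by (simp add: T_def algebra_simps)
  qed
  then have xs: "x * s' z = s' z * x" for z
    unfolding s'_def using s(3) by blast
  \<comment> \<open>\<open>T\<close> is F-linear on both sides, so commutation of \<open>s\<close>
    with elements of F survives the correction.\<close>
  have "f * s' z = s' z * f" if "f \<in> F" "\<And>z. f * s z = s z * f" for f z
    unfolding s'_def using ops_linear(2,3)[OF T that(1), of "s z"] that(2) by simp
  with s' one xs show ?thesis by blast
qed

lemma ops_formal: "T \<in> ops \<Longrightarrow> \<exists>p\<in>formal F 2. \<forall>z. T z = lin (\<lambda>xs. xs ! 0 * z * xs ! 1) p"
proof (induction rule: ops.induct)
  case (sandwich x y)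
  then show ?case
    by (intro bexI[of _ "Poly_Mapping.single [x, y] 1"]) (auto intro: formal_single simp: tuples_2)
next
  case (add S T)
  then obtain p q where "p \<in> formal F 2" "\<And>z. S z = lin (\<lambda>xs. xs ! 0 * z * xs ! 1) p"
    "q \<in> formal F 2" "\<And>z. T z = lin (\<lambda>xs. xs ! 0 * z * xs ! 1) q" by blast
  then show ?case
    by (intro bexI[of _ "p + q"]) (auto simp: lin_add formal_add)
qed

end

section \<open>The separability idempotent and trace duality\<close>

locale etale_in_csa = commutative_in_csa scale F
  for scale :: "'k::field \<Rightarrow> 'a::ring_1 \<Rightarrow> 'a" (infixr "*s" 75) and F +
  assumes etale: "etale_subalgebra F"
begin

text \<open>The separability idempotent in operator form: \<open>s 1 = 1\<close> says that
  multiplication sends it to 1, the commutation that left and right multiplication by F agree on it.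
  Elements of the factor fields are treated one by one; each step keeps the commutations already
  achieved.\<close>

lemma separability_operator:
  "\<exists>s\<in>ops. s 1 = 1 \<and> (\<forall>f\<in>F. \<forall>z. f * s z = s z * f)"
proof -
  obtain E where "finite E \<and> E \<subseteq> F \<and> (\<forall>e\<in>E. e * e = e) \<and>
      (\<forall>e\<in>E. \<forall>e'\<in>E. e \<noteq> e' \<longrightarrow> e * e' = 0) \<and> (\<Sum>e\<in>E. e) = 1 \<and>
      (\<forall>e\<in>E. factor_field F e \<and> factor_separable F e)"
    using etale unfolding etale_subalgebra_def by (elim conjE exE) (intro that conjI)
  then have E: "finite E" "E \<subseteq> F" "\<And>e. e \<in> E \<Longrightarrow> e * e = e"
      "\<And>e e'. e \<in> E \<Longrightarrow> e' \<in> E \<Longrightarrow> e \<noteq> e' \<Longrightarrow> e * e' = 0" "(\<Sum>e\<in>E. e) = 1"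
      "\<And>e. e \<in> E \<Longrightarrow> factor_field F e" "\<And>e. e \<in> E \<Longrightarrow> factor_separable F e"
    by simp_all
  have EF: "(\<Union>e\<in>E. (\<lambda>f. f * e) ` F) \<subseteq> F"
  proof clarify
    fix e f assume "e \<in> E" "f \<in> F"
    with E(2) show "f * e \<in> F" by (intro F_mult) blast+
  qed
  have step: "\<exists>s\<in>ops. s 1 = 1 \<and> (\<forall>x\<in>E \<union> X. \<forall>z. x * s z = s z * x)"
    if "finite X" "X \<subseteq> (\<Union>e\<in>E. (\<lambda>f. f * e) ` F)" for X
    using that
  proof (induction X rule: finite_induct)
    case empty
    \<comment> \<open>The separability idempotent of the span of \<open>E\<close>; cross terms
      vanish by orthogonality. It supplies the commutation with \<open>e\<close> on which
      \<open>separability_step\<close> depends.\<close>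
    define s where "s z = (\<Sum>e\<in>E. e * z * e)" for z
    have "s \<in> ops" unfolding s_def using E(2) by (intro ops_sum ops.sandwich) auto
    moreover have "s 1 = 1" using E(3,5) by (simp add: s_def)
    moreover have "e * s z = s z * e" if e: "e \<in> E" for e z
    proof -
      have "e * s z = (\<Sum>e'\<in>E. if e' = e then e * z * e else 0)"
        unfolding s_def sum_distrib_left using E(3,4) e
        by (intro sum.cong) (auto simp: mult.assoc[symmetric])
      moreover have "s z * e = (\<Sum>e'\<in>E. if e' = e then e * z * e else 0)"
        unfolding s_def sum_distrib_right using E(3,4) e
        by (intro sum.cong) (auto simp: mult.assoc)
      ultimately show ?thesis by simp
    qed
    ultimately show ?case by auto
  next
    case (insert x X)
    then obtain s where s: "s \<in> ops" "s 1 = 1" "\<And>x z. x \<in> E \<union> X \<Longrightarrow> x * s z = s z * x"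
      by auto
    from insert.prems obtain e where e: "e \<in> E" "x \<in> (\<lambda>f. f * e) ` F" by auto
    have eF: "e \<in> F" "e * e = e" using e E by auto
    have x: "x \<in> F" "x * e = x" "e * x = x"
      using e(2) eF F_commute[of e x] by (auto simp: mult.assoc)
    obtain p where p: "irreducible p" "coprime p (pderiv p)" "peval e x p = 0"
      using E(7)[OF e(1)] e(2) unfolding factor_separable_def peval_def by blast
    have field: "e \<noteq> 0" "\<And>x. x \<in> (\<lambda>f. f * e) ` F \<Longrightarrow> x \<noteq> 0 \<Longrightarrow> \<exists>y\<in>(\<lambda>f. f * e) ` F. x * y = e"
      using E(6)[OF e(1)] unfolding factor_field_def by blast+
    have "p \<noteq> 0" using p(1) by auto
    then have "peval e x (pderiv p) \<noteq> 0"
      by (rule peval_pderiv_nonzero[OF eF(2) x(2,3) field(1) _ p(2,3)])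
    moreover have "peval e x (pderiv p) \<in> (\<lambda>f. f * e) ` F"
    proof -
      have "peval e x q * e = peval e x q" for q
        using eF x by (induction q) (simp_all add: distrib_right scale_mult_left mult.assoc)
      then show ?thesis using peval_F[OF eF(1) x(1)] by (metis image_eqI)
    qed
    ultimately obtain y where "y \<in> (\<lambda>f. f * e) ` F" "peval e x (pderiv p) * y = e"
      using field(2) by meson
    then have "y \<in> F" "peval e x (pderiv p) * y = e" using eF by auto
    from separability_step[OF s(1,2) s(3) eF x(1,2) p(3) this] e(1)
    obtain s' where s': "s' \<in> ops" "s' 1 = 1" "\<And>z. x * s' z = s' z * x"
      "\<And>f z. f \<in> F \<Longrightarrow> (\<And>z. f * s z = s z * f) \<Longrightarrow> f * s' z = s' z * f" by blast
    have "E \<union> X \<subseteq> F" using E(2) insert.prems EF by blast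
    then have "f * s' z = s' z * f" if "f \<in> E \<union> X" for f z
      using s'(4)[of f z] s(3) that by blast
    with s' show ?case by (intro bexI[of _ s']) auto
  qed
  \<comment> \<open>Each \<open>b * e\<close> lies in a single factor field, as the step requires,
    and summing over \<open>e\<close> recovers \<open>b\<close>, since the idempotents sum to
    1.\<close>
  define X where "X = (\<lambda>(b, e). b * e) ` (basis \<times> E)"
  have "finite X" "X \<subseteq> (\<Union>e\<in>E. (\<lambda>f. f * e) ` F)"
    using E(1) finite_basis by (auto simp: X_def)
  from step[OF this] obtain s where s: "s \<in> ops" "s 1 = 1" "\<And>x z. x \<in> X \<Longrightarrow> x * s z = s z * x"
    by (meson UnI2)
  have s3: "b * e * s z = s z * (b * e)" if "b \<in> basis" "e \<in> E" for b e z
    by (rule s(3)) (use that in \<open>auto simp: X_def\<close>)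
  have "f * s z = s z * f" if "f \<in> F" for f z
  proof -
    have "f \<in> span basis" using that basis by simp
    then show ?thesis
    proof (induction rule: span_induct_alt)
      case (step c b f)
      have "b * s z = (\<Sum>e\<in>E. b * e * s z)"
        by (simp add: sum_distrib_left[symmetric] sum_distrib_right[symmetric] E(5))
      also have "\<dots> = (\<Sum>e\<in>E. s z * (b * e))" using s3 step by (intro sum.cong) simp_all
      also have "\<dots> = s z * b" by (simp add: sum_distrib_left[symmetric] E(5))
      finally show ?case using step
        by (simp add: distrib_left distrib_right scale_mult_left scale_mult_right)
    qed simp
  qed
  with s(1,2) show ?thesis by blast
qed

text \<open>The trace is the sum over \<open>b\<close> of the coordinate at \<open>b\<close> of f b
  s_0. The factor f b may be moved from s_0 to s_1, and the coordinates of s_0 times the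
  \<open>b\<close> sum to s_0. What is left is sum f s_0 s_1, which is f because
  \<open>S 1 = 1\<close>.\<close>

lemma trace_duality:
  obtains s where "s \<in> formal F 2"
    "\<And>f. f \<in> F \<Longrightarrow> lin (\<lambda>xs. Tr F (f * xs ! 0) *s xs ! 1) s = f"
proof -
  obtain S where S: "S \<in> ops" "S 1 = 1" "\<And>f z. f \<in> F \<Longrightarrow> f * S z = S z * f"
    using separability_operator by blast
  obtain s where s: "s \<in> formal F 2" "\<And>z. S z = lin (\<lambda>xs. xs ! 0 * z * xs ! 1) s"
    using ops_formal[OF S(1)] by blast
  \<comment> \<open>A coordinate is not an operator on A, so (f \<otimes> 1) s = (1 \<otimes> f) s
    is needed in the tensor power itself: it is checked on words, and only then is the multilinear
    map built from the coordinate applied.\<close>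
  have shift: "lin (\<lambda>xs. representation basis (f * xs ! 0) b *s xs ! 1) s =
      lin (\<lambda>xs. representation basis (xs ! 0) b *s (f * xs ! 1)) s" if f: "f \<in> F" for f b
  proof -
    define s1 where "s1 = (\<Sum>xs\<in>Poly_Mapping.keys s.
      Poly_Mapping.single [f * xs ! 0, xs ! 1] (1 * Poly_Mapping.lookup s xs))"
    define s2 where "s2 = (\<Sum>xs\<in>Poly_Mapping.keys s.
      Poly_Mapping.single [xs ! 0, f * xs ! 1] (1 * Poly_Mapping.lookup s xs))"
    have "s1 \<in> formal F 2" "s2 \<in> formal F 2"
      unfolding s1_def s2_def using f by (auto intro!: formal_sum_keys[OF s(1)] simp: tuples_2)
    moreover have "lin (word_prod ys) (s1 - s2) = 0" if ys: "length ys = 2" for ys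
    proof -
      obtain y z where ys: "ys = [y, z]" using ys by (auto simp: length_Suc_conv numeral_2_eq_2)
      have "lin (word_prod ys) s1 = lin (\<lambda>xs. f * (xs ! 0 * y * xs ! 1) * z) s"
        unfolding s1_def lin_reindex ys by (simp add: mult.assoc)
      also have "\<dots> = f * S y * z" by (simp only: lin_mult_left lin_mult_right s(2))
      also have "\<dots> = S y * f * z" using S(3)[OF f] by simp
      also have "\<dots> = lin (\<lambda>xs. (xs ! 0 * y * xs ! 1) * f * z) s" by (simp only: lin_mult_right s(2))
      also have "\<dots> = lin (word_prod ys) s2"
        unfolding s2_def lin_reindex ys using f
        by (intro lin_formal_cong[OF s(1)]) (auto simp: tuples_2 mult.assoc F_left_commute)
      finally show ?thesis by (simp add: lin_diff)
    qed
    ultimately have "s1 - s2 \<in> tensor_relations F 2"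
      by (simp add: relations_iff formal_diff)
    from lin_relations[OF _ this, of "\<lambda>xs. representation basis (xs ! 0) b *s xs ! 1"]
    have "lin (\<lambda>xs. representation basis (xs ! 0) b *s xs ! 1) s1
        = lin (\<lambda>xs. representation basis (xs ! 0) b *s xs ! 1) s2"
      by (simp add: lin_diff multilinear_2I basis_coord_add basis_coord_scale
          scale_left_distrib scale_right_distrib mult.commute)
    then show ?thesis
      unfolding s1_def s2_def lin_reindex by simp
  qed
  have "lin (\<lambda>xs. Tr F (f * xs ! 0) *s xs ! 1) s = f" if f: "f \<in> F" for f
  proof -
    have "lin (\<lambda>xs. Tr F (f * xs ! 0) *s xs ! 1) s =
        lin (\<lambda>xs. \<Sum>b\<in>basis. representation basis (f * b * xs ! 0) b *s xs ! 1) s"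
      by (rule lin_formal_cong[OF s(1)])
        (auto simp: tuples_2 Tr_eq scale_sum_left mult.assoc F_commute[OF basis_F])
    also have "\<dots> = (\<Sum>b\<in>basis. lin (\<lambda>xs. representation basis (xs ! 0) b *s (f * b * xs ! 1)) s)"
      unfolding lin_sum_fun using f by (intro sum.cong refl shift) simp
    also have "\<dots> = lin (\<lambda>xs. f * (\<Sum>b\<in>basis. representation basis (xs ! 0) b *s b) * xs ! 1) s"
      unfolding lin_sum_fun[symmetric]
      by (simp add: sum_distrib_left sum_distrib_right scale_mult_left scale_mult_right mult.assoc)
    also have "\<dots> = lin (\<lambda>xs. f * (xs ! 0 * 1 * xs ! 1)) s"
      by (rule lin_formal_cong[OF s(1)]) (auto simp: tuples_2 basis_expand mult.assoc)
    also have "\<dots> = f * S 1" by (simp only: lin_mult_left s(2))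
    finally show ?thesis using S(2) by simp
  qed
  with s(1) show thesis by (rule that)
qed

end

text \<open>A dimension count: both families are indexed by \<open>I\<close>, and \<open>g\<close>
  is independent. Independence is that of the family, not of its image, so it also excludes
  repetitions.\<close>

lemma (in vector_space) span_eq_span_of_independent_family:
  assumes I: "finite I" and g: "\<And>i. i \<in> I \<Longrightarrow> g i \<in> span (h ` I)"
    and indep: "\<And>a i. (\<Sum>i\<in>I. a i *s g i) = 0 \<Longrightarrow> i \<in> I \<Longrightarrow> a i = 0"
  shows "span (h ` I) \<subseteq> span (g ` I)"
proof
  fix x assume x: "x \<in> span (h ` I)"
  have inj: "inj_on g I"
  proof (rule inj_onI, rule ccontr)
    fix i j assume ij: "i \<in> I" "j \<in> I" "g i = g j" "i \<noteq> j"
    have "(\<Sum>k\<in>I. ((if k = i then 1 else 0) - (if k = j then 1 else 0)) *s g k) =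
        (\<Sum>k\<in>I. if k = i then g k else 0) - (\<Sum>k\<in>I. if k = j then g k else 0)"
      unfolding sum_subtractf[symmetric] by (intro sum.cong) (auto simp: algebra_simps)
    also have "\<dots> = 0" using I ij by simp
    finally show False
      using indep[of "\<lambda>k. (if k = i then 1 else 0) - (if k = j then 1 else 0)" i] ij by simp
  qed
  have "independent (g ` I)"
  proof (rule independent_if_scalars_zero)
    fix f x assume "(\<Sum>x\<in>g ` I. f x *s x) = 0" and x: "x \<in> g ` I"
    then have "(\<Sum>i\<in>I. f (g i) *s g i) = 0" by (simp add: sum.reindex[OF inj])
    with indep[of "\<lambda>i. f (g i)"] x show "f x = 0" by blast
  qed (use I in simp)
  moreover have "\<not> independent (insert x (g ` I))" if "x \<notin> g ` I"
  proof
    assume "independent (insert x (g ` I))"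
    moreover have "insert x (g ` I) \<subseteq> span (h ` I)" using x g by auto
    ultimately have "card (insert x (g ` I)) \<le> card (h ` I)"
      using independent_span_bound I by blast
    moreover have "card (insert x (g ` I)) = Suc (card I)"
      using I that by (simp add: card_image[OF inj])
    ultimately show False using card_image_le[OF I, of h] by simp
  qed
  ultimately show "x \<in> span (g ` I)"
    using independent_insert span_base by metis
qed

context k_algebra
begin

section \<open>Operations on formal sums\<close>

text \<open>\<open>fmult\<close>, \<open>fface\<close> and \<open>ftrace\<close> repeat the bodies
  inside \<open>formal_ring\<close>, \<open>face\<close> and \<open>Tr32\<close>, so that
  calculations can be made on representatives.\<close>

definition fmult :: "('a list \<Rightarrow>\<^sub>0 'k) \<Rightarrow> ('a list \<Rightarrow>\<^sub>0 'k) \<Rightarrow> ('a list \<Rightarrow>\<^sub>0 'k)" where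
  "fmult p q = (\<Sum>xs\<in>Poly_Mapping.keys p. \<Sum>ys\<in>Poly_Mapping.keys q.
     Poly_Mapping.single (map2 (*) xs ys) (Poly_Mapping.lookup p xs * Poly_Mapping.lookup q ys))"

definition fface :: "nat \<Rightarrow> ('a list \<Rightarrow>\<^sub>0 'k) \<Rightarrow> ('a list \<Rightarrow>\<^sub>0 'k)" where
  "fface i p = (\<Sum>xs\<in>Poly_Mapping.keys p.
     Poly_Mapping.single (take i xs @ 1 # drop i xs) (Poly_Mapping.lookup p xs))"

definition ftrace :: "'a set \<Rightarrow> ('a list \<Rightarrow>\<^sub>0 'k) \<Rightarrow> ('a list \<Rightarrow>\<^sub>0 'k)" where
  "ftrace F p = (\<Sum>xs\<in>Poly_Mapping.keys p.
     Poly_Mapping.single [xs ! 0, xs ! 2] (Tr F (xs ! 1) * Poly_Mapping.lookup p xs))"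

text \<open>At \<open>z = v\<close> this is the value of \<open>Phi v\<close> on the class of
  \<open>p\<close>, see \<open>Phi_class\<close>.\<close>

definition act :: "('a list \<Rightarrow>\<^sub>0 'k) \<Rightarrow> 'a \<Rightarrow> 'a" where
  "act p z = lin (\<lambda>xs. xs ! 0 * z * xs ! 1) p"

lemma lin_const_zero [simp]: "lin (\<lambda>xs. 0) p = 0"
  by (simp add: lin_def)

lemma lin_fmult: "lin g (fmult p q) = lin (\<lambda>xs. lin (\<lambda>ys. g (map2 (*) xs ys)) q) p"
  unfolding fmult_def lin_sum lin_single by (simp add: lin_def scale_sum_right)

lemma lin_fface: "lin g (fface i p) = lin (\<lambda>xs. g (take i xs @ 1 # drop i xs)) p"
  unfolding fface_def lin_sum lin_single by (simp add: lin_def)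

lemma lin_ftrace: "lin g (ftrace F p) = lin (\<lambda>xs. Tr F (xs ! 1) *s g [xs ! 0, xs ! 2]) p"
  unfolding ftrace_def by (rule lin_reindex)

lemma map2_assoc: "map2 (*) (map2 (*) xs ys) zs = map2 (*) xs (map2 (*) ys (zs :: 'a list))"
  by (induction xs ys arbitrary: zs rule: list_induct2')
    (auto simp: mult.assoc zip_Cons1 split: list.splits)

lemma fmult_assoc: "fmult (fmult p q) r = fmult p (fmult q r)"
  by (rule formal_eqI) (simp add: lin_fmult map2_assoc)

lemma fmult_add_left: "fmult (p + q) r = fmult p r + fmult q r"
  by (rule formal_eqI) (simp add: lin_fmult lin_add)

end

section \<open>Compatibility with the relations, and units among regular elements\<close>

context commutative_in_csa
begin

lemma tuples_map2: "xs \<in> tuples F n \<Longrightarrow> ys \<in> tuples F n \<Longrightarrow> map2 (*) xs ys \<in> tuples F n"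
  by (auto simp: tuples_def elim!: in_set_zipE intro!: F_mult)

lemma tuples_insert: "xs \<in> tuples F n \<Longrightarrow> i \<le> n \<Longrightarrow> take i xs @ 1 # drop i xs \<in> tuples F (Suc n)"
  by (auto simp: tuples_def dest: in_set_takeD in_set_dropD)

lemma fmult_formal: "p \<in> formal F n \<Longrightarrow> q \<in> formal F n \<Longrightarrow> fmult p q \<in> formal F n"
  unfolding fmult_def
  by (intro formal_sum formal_single tuples_map2) (auto simp: formal_def)

lemma fface_formal: "p \<in> formal F n \<Longrightarrow> i \<le> n \<Longrightarrow> fface i p \<in> formal F (Suc n)"
  unfolding fface_def by (rule formal_sum_keys, assumption) (rule tuples_insert)

lemma ftrace_formal: "p \<in> formal F 3 \<Longrightarrow> ftrace F p \<in> formal F 2"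
  unfolding ftrace_def by (rule formal_sum_keys, assumption) (auto simp: tuples_2 tuples_3)

lemma fmult_commute:
  assumes "p \<in> formal F n" "q \<in> formal F n"
  shows "fmult p q = fmult q p"
proof (rule formal_eqI)
  fix g
  have "map2 (*) xs ys = map2 (*) ys xs" if "xs \<in> tuples F n" "ys \<in> tuples F n" for xs ys
    using that by (intro nth_equalityI) (auto simp: tuples_def subset_iff intro!: F_commute)
  then have "lin (\<lambda>xs. lin (\<lambda>ys. g (map2 (*) xs ys)) q) p = lin (\<lambda>xs. lin (\<lambda>ys. g (map2 (*) ys xs)) q) p"
    using assms by (intro lin_formal_cong[of _ F n]) auto
  then show "lin g (fmult p q) = lin g (fmult q p)"
    unfolding lin_fmult by (subst (2) lin_swap)
qed

lemma fmult_add_right: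
  assumes "p \<in> formal F n" "q \<in> formal F n" "r \<in> formal F n"
  shows "fmult r (p + q) = fmult r p + fmult r q"
  using assms by (simp add: fmult_commute[of r n] formal_add fmult_add_left)

lemma fmult_scale_right: "fmult p (formal_scale a q) = formal_scale a (fmult p q)"
  by (rule formal_eqI) (simp add: lin_fmult lin_formal_scale lin_scale_fun)

lemma fmult_sum_right: "fmult p (\<Sum>i\<in>I. Q i) = (\<Sum>i\<in>I. fmult p (Q i))"
  by (rule formal_eqI) (simp add: lin_fmult lin_sum lin_sum_fun)

lemma fmult_one:
  assumes "p \<in> formal F n"
  shows "fmult (Poly_Mapping.single (replicate n 1) 1) p = p"
proof (rule formal_eqI)
  fix g
  have "map2 (*) (replicate n 1) xs = xs" if "xs \<in> tuples F n" for xs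
    using that by (intro nth_equalityI) (auto simp: tuples_def)
  then show "lin g (fmult (Poly_Mapping.single (replicate n 1) 1) p) = lin g p"
    unfolding lin_fmult by (simp cong: lin_formal_cong[OF assms])
qed

lemma one_formal: "Poly_Mapping.single (replicate n 1) 1 \<in> formal F n"
  by (rule formal_single) (auto simp: tuples_def)

lemma fmult_relations:
  assumes "p \<in> formal F n" "q \<in> tensor_relations F n"
  shows "fmult p q \<in> tensor_relations F n"
  unfolding relations_iff
proof (intro conjI allI impI)
  have q: "q \<in> formal F n" using assms(2) by (simp add: relations_iff)
  show "fmult p q \<in> formal F n" using assms(1) q by (rule fmult_formal)
  fix ys :: "'a list" assume ys: "length ys = n"
  have "lin (\<lambda>xs. word_prod ys (map2 (*) zs xs)) q = 0" if "zs \<in> tuples F n" for zs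
    using that by (intro lin_relations[OF _ assms(2)] multilinear_map2 word_prod_multilinear ys F_mult)
  then have "lin (\<lambda>zs. lin (\<lambda>xs. word_prod ys (map2 (*) zs xs)) q) p = lin (\<lambda>zs. 0) p"
    by (intro lin_formal_cong[OF assms(1)])
  then show "lin (word_prod ys) (fmult p q) = 0"
    by (simp add: lin_fmult)
qed

lemma fface_relations:
  assumes "p \<in> tensor_relations F n" "i \<le> n"
  shows "fface i p \<in> tensor_relations F (Suc n)"
  unfolding relations_iff
proof (intro conjI allI impI)
  show "fface i p \<in> formal F (Suc n)" using assms by (simp add: relations_iff fface_formal)
  fix ys :: "'a list" assume ys: "length ys = Suc n"
  then show "lin (word_prod ys) (fface i p) = 0"
    unfolding lin_fface using assms(2)
    by (intro lin_relations[OF multilinear_insert assms(1)] word_prod_multilinear) auto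
qed

lemma ftrace_relations:
  assumes "p \<in> tensor_relations F 3"
  shows "ftrace F p \<in> tensor_relations F 2"
  unfolding relations_iff
proof (intro conjI allI impI)
  show "ftrace F p \<in> formal F 2" using assms by (simp add: relations_iff ftrace_formal)
  fix ys :: "'a list" assume "length ys = 2"
  then obtain y z where ys: "ys = [y, z]" by (auto simp: length_Suc_conv numeral_2_eq_2)
  show "lin (word_prod ys) (ftrace F p) = 0"
    unfolding lin_ftrace ys
    by (intro lin_relations[OF _ assms] multilinear_3I)
      (simp_all add: Tr_add Tr_scale algebra_simps scale_mult_left scale_mult_right)
qed

lemma fmult_fface:
  assumes "p \<in> formal F n" "q \<in> formal F n" "i \<le> n"
  shows "fface i (fmult p q) = fmult (fface i p) (fface i q)"
proof (rule formal_eqI)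
  fix g
  have "take i (map2 (*) xs ys) @ 1 # drop i (map2 (*) xs ys) =
      map2 (*) (take i xs @ 1 # drop i xs) (take i ys @ 1 # drop i ys)"
    if "xs \<in> tuples F n" "ys \<in> tuples F n" for xs ys
    using that by (simp add: tuples_def take_map drop_map take_zip drop_zip)
  then show "lin g (fface i (fmult p q)) = lin g (fmult (fface i p) (fface i q))"
    unfolding lin_fmult lin_fface using assms by (intro lin_formal_cong[of _ F n]) auto
qed

text \<open>The reason is that the tensor power is finite dimensional over \<open>k\<close>.\<close>

lemma regular_imp_unit:
  assumes c: "c \<in> formal F n"
    and reg: "\<And>t. t \<in> formal F n \<Longrightarrow> fmult c t \<in> tensor_relations F n \<Longrightarrow> t \<in> tensor_relations F n"
  obtains t where "t \<in> formal F n"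
    "fmult c t - Poly_Mapping.single (replicate n 1) 1 \<in> tensor_relations F n"
proof -
  let ?R = "tensor_relations F n"
  let ?I = "tuples basis n"
  define h :: "'a list \<Rightarrow> ('a list \<Rightarrow>\<^sub>0 'k)" where "h bs = Poly_Mapping.single bs 1" for bs
  have h: "h bs \<in> formal F n" if "bs \<in> ?I" for bs
    unfolding h_def using that basis(1) by (intro formal_single) (auto simp: tuples_def)
  have fin: "finite ?I" by (rule finite_tuples[OF finite_basis])
  \<comment> \<open>\<open>g bs\<close> represents the product of \<open>c\<close> with a basis
    tuple, rewritten in basis tuples.\<close>
  have "\<exists>g. g \<in> formal.span (h ` ?I) \<and> fmult c (h bs) - g \<in> ?R" if "bs \<in> ?I" for bs
    using relations_basis_tuples[OF basis(1,3) finite_basis fmult_formal[OF c h[OF that]]]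
    unfolding h_def by blast
  then obtain g where g: "\<And>bs. bs \<in> ?I \<Longrightarrow> g bs \<in> formal.span (h ` ?I)"
    "\<And>bs. bs \<in> ?I \<Longrightarrow> fmult c (h bs) - g bs \<in> ?R"
    by metis
  have lincomb: "fmult c (\<Sum>bs\<in>?I. formal_scale (a bs) (h bs)) - (\<Sum>bs\<in>?I. formal_scale (a bs) (g bs)) \<in> ?R"
    for a
    unfolding fmult_sum_right fmult_scale_right sum_subtractf[symmetric]
      formal.scale_right_diff_distrib[symmetric]
    by (intro formal.subspace_sum formal.subspace_scale relations_subspace g)
  have comb: "(\<Sum>bs\<in>?I. formal_scale (a bs) (h bs)) \<in> formal F n" for a
    by (intro formal_sum formal_scale_closed h)
  \<comment> \<open>Regularity makes the products \<open>g bs\<close> independent, so they span by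
    dimension and in particular reach the unit.\<close>
  have "formal.span (h ` ?I) \<subseteq> formal.span (g ` ?I)"
  proof (rule formal.span_eq_span_of_independent_family[OF fin g(1)])
    fix a bs assume "(\<Sum>bs\<in>?I. formal_scale (a bs) (g bs)) = 0" and bs: "bs \<in> ?I"
    with lincomb[of a] reg[OF comb] have "(\<Sum>bs\<in>?I. formal_scale (a bs) (h bs)) \<in> ?R"
      by simp
    then show "a bs = 0"
      unfolding h_def using bs by (rule singles_independent)
  qed
  moreover obtain q where "q \<in> formal.span (h ` ?I)" "Poly_Mapping.single (replicate n 1) 1 - q \<in> ?R"
    using relations_basis_tuples[OF basis(1,3) finite_basis one_formal] unfolding h_def by blast
  ultimately have q: "q \<in> formal.span (g ` ?I)" "Poly_Mapping.single (replicate n 1) 1 - q \<in> ?R"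
    by auto
  have "\<exists>a. q = (\<Sum>bs\<in>?I. formal_scale (a bs) (g bs))"
    using q(1)
  proof (induction rule: formal.span_induct_alt)
    case base
    show ?case by (intro exI[of _ "\<lambda>_. 0"]) simp
  next
    case (step r x y)
    then obtain a bs where "y = (\<Sum>bs\<in>?I. formal_scale (a bs) (g bs))" "x = g bs" "bs \<in> ?I" by blast
    then show ?case
      using fin by (intro exI[of _ "\<lambda>cs. (if cs = bs then r else 0) + a cs"])
        (simp add: formal.scale_left_distrib sum.distrib if_distrib[of "\<lambda>r. formal_scale r _"]
          cong: if_cong)
  qed
  then obtain a where a: "q = (\<Sum>bs\<in>?I. formal_scale (a bs) (g bs))" by blast
  let ?t = "\<Sum>bs\<in>?I. formal_scale (a bs) (h bs)"
  have "fmult c ?t - Poly_Mapping.single (replicate n 1) 1 =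
      (fmult c ?t - q) - (Poly_Mapping.single (replicate n 1) 1 - q)" by simp
  also have "\<dots> \<in> ?R"
    using lincomb[of a] q(2) unfolding a by (rule formal.subspace_diff[OF relations_subspace])
  finally show thesis by (rule that[OF comb])
qed

end

section \<open>The cocycle of a generator\<close>

locale generated_csa = etale_in_csa scale F
  for scale :: "'k::field \<Rightarrow> 'a::ring_1 \<Rightarrow> 'a" (infixr "*s" 75) and F +
  fixes v :: 'a
  assumes generates: "bimodule_span F v = UNIV"
begin

lemma act_surj: "\<exists>p\<in>formal F 2. act p v = z"
proof -
  have "z \<in> span {r\<^sub>1 * v * r\<^sub>2 | r\<^sub>1 r\<^sub>2. r\<^sub>1 \<in> F \<and> r\<^sub>2 \<in> F}"
    using generates by (simp add: bimodule_span_def)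
  then show ?thesis
  proof (induction rule: span_induct_alt)
    case base
    show ?case by (intro bexI[of _ 0]) (simp_all add: act_def)
  next
    case (step a x z)
    then obtain p r s where "p \<in> formal F 2" "act p v = z" "r \<in> F" "s \<in> F" "x = r * v * s" by blast
    then show ?case
      by (intro bexI[of _ "Poly_Mapping.single [r, s] a + p"])
        (auto simp: act_def lin_add tuples_2 intro!: formal_add formal_single)
  qed
qed

text \<open>Write \<open>z\<close> as a sum of r v s. As r and s commute with the outer entries,
  they come out of the sum. The scalars \<open>a xs\<close> will be 1 or products of traces of the
  inner entries.\<close>

lemma lin_eq_0_of_generator:
  assumes q: "q \<in> formal F n" and "i < n" "j < n"
    and v: "lin (\<lambda>xs. a xs *s (xs ! i * v * xs ! j)) q = 0"
  shows "lin (\<lambda>xs. a xs *s (xs ! i * z * xs ! j)) q = 0"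
proof -
  obtain p where p: "p \<in> formal F 2" "act p v = z" using act_surj by blast
  have "lin (\<lambda>xs. a xs *s (xs ! i * z * xs ! j)) q =
      lin (\<lambda>xs. lin (\<lambda>ys. a xs *s (xs ! i * (ys ! 0 * v * ys ! 1) * xs ! j)) p) q"
    unfolding p(2)[symmetric] act_def
    by (simp only: lin_scale_fun lin_mult_left lin_mult_right)
  also have "\<dots> = lin (\<lambda>ys. lin (\<lambda>xs. a xs *s (xs ! i * (ys ! 0 * v * ys ! 1) * xs ! j)) q) p"
    by (rule lin_swap)
  also have "\<dots> = lin (\<lambda>ys. lin (\<lambda>xs. ys ! 0 * (a xs *s (xs ! i * v * xs ! j)) * ys ! 1) q) p"
  proof (rule lin_formal_cong[OF p(1)], rule lin_formal_cong[OF q])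
    fix xs ys assume "xs \<in> tuples F n" "ys \<in> tuples F 2"
    then have "xs ! i \<in> F" "xs ! j \<in> F" "ys ! 0 \<in> F" "ys ! 1 \<in> F"
      using assms(2,3) by (auto simp: tuples_def)
    then show "a xs *s (xs ! i * (ys ! 0 * v * ys ! 1) * xs ! j) =
        ys ! 0 * (a xs *s (xs ! i * v * xs ! j)) * ys ! 1"
      by (simp add: scale_mult_left scale_mult_right mult.assoc F_left_commute F_commute)
  qed
  also have "\<dots> = 0"
    by (simp only: lin_mult_left lin_mult_right v) (simp add: lin_def)
  finally show ?thesis .
qed

lemma act_inj:
  assumes "p \<in> formal F 2" "act p v = 0"
  shows "p \<in> tensor_relations F 2"
  unfolding relations_iff
proof (intro conjI allI impI)
  fix ys :: "'a list" assume "length ys = 2"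
  then obtain y z where ys: "ys = [y, z]" by (auto simp: length_Suc_conv numeral_2_eq_2)
  \<comment> \<open>The scalar 1 gives the sum the form of \<open>lin_eq_0_of_generator\<close>; the
    last letter is a common right factor.\<close>
  have "lin (word_prod ys) p = lin (\<lambda>xs. 1 *s (xs ! 0 * y * xs ! 1) * z) p"
    by (rule lin_formal_cong[OF assms(1)]) (auto simp: tuples_2 ys mult.assoc)
  also have "\<dots> = 0"
    using assms(2) lin_eq_0_of_generator[OF assms(1), of 0 1 "\<lambda>_. 1" y]
    by (simp only: lin_mult_right) (simp add: act_def)
  finally show "lin (word_prod ys) p = 0" .
qed (rule assms)

text \<open>Trace duality replaces the middle entry x_2 of a word by sum Tr(x_2 s_0) s_1. Then y_1
  s_1 y_2 is a single element of A between the outer entries, and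
  \<open>lin_eq_0_of_generator\<close> reduces it to \<open>v\<close>.\<close>

lemma relations_3_of_traces:
  assumes q: "q \<in> formal F 3"
    and v: "\<And>x. x \<in> F \<Longrightarrow> lin (\<lambda>xs. Tr F (xs ! 1 * x) *s (xs ! 0 * v * xs ! 2)) q = 0"
  shows "q \<in> tensor_relations F 3"
  unfolding relations_iff
proof (intro conjI allI impI)
  obtain s where s: "s \<in> formal F 2"
    "\<And>f. f \<in> F \<Longrightarrow> lin (\<lambda>xs. Tr F (f * xs ! 0) *s xs ! 1) s = f"
    by (rule trace_duality) blast
  fix ys :: "'a list" assume "length ys = 3"
  then obtain y1 y2 y3 where ys: "ys = [y1, y2, y3]" by (auto simp: length_Suc_conv numeral_3_eq_3)
  have "lin (word_prod ys) q =
      lin (\<lambda>xs. lin (\<lambda>ss. Tr F (xs ! 1 * ss ! 0) *s (xs ! 0 * (y1 * ss ! 1 * y2) * xs ! 2) * y3) s) q"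
  proof (rule lin_formal_cong[OF q])
    fix xs assume "xs \<in> tuples F 3"
    then obtain x1 x2 x3 where xs: "xs = [x1, x2, x3]" "x2 \<in> F" by (auto simp: tuples_3)
    have "word_prod ys xs = x1 * y1 * lin (\<lambda>ss. Tr F (x2 * ss ! 0) *s ss ! 1) s * (y2 * x3 * y3)"
      unfolding s(2)[OF xs(2)] by (simp add: ys xs mult.assoc)
    also have "\<dots> = lin (\<lambda>ss. x1 * y1 * (Tr F (x2 * ss ! 0) *s ss ! 1) * (y2 * x3 * y3)) s"
      by (simp only: lin_mult_left lin_mult_right)
    finally show "word_prod ys xs =
        lin (\<lambda>ss. Tr F (xs ! 1 * ss ! 0) *s (xs ! 0 * (y1 * ss ! 1 * y2) * xs ! 2) * y3) s"
      by (simp add: xs scale_mult_left scale_mult_right mult.assoc)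
  qed
  also have "\<dots> = lin (\<lambda>ss. lin (\<lambda>xs. Tr F (xs ! 1 * ss ! 0) *s (xs ! 0 * (y1 * ss ! 1 * y2) * xs ! 2)) q * y3) s"
    unfolding lin_mult_right[symmetric] by (rule lin_swap)
  also have "\<dots> = lin (\<lambda>ss. 0) s"
  proof (rule lin_formal_cong[OF s(1)])
    fix ss assume "ss \<in> tuples F 2"
    then have "ss ! 0 \<in> F" by (auto simp: tuples_2)
    from lin_eq_0_of_generator[OF q _ _ v[OF this]]
    show "lin (\<lambda>xs. Tr F (xs ! 1 * ss ! 0) *s (xs ! 0 * (y1 * ss ! 1 * y2) * xs ! 2)) q * y3 = 0"
      by simp
  qed
  finally show "lin (word_prod ys) q = 0" by simp
qed (rule q)

text \<open>As with three entries, but both inner ones are expanded: \<open>w\<close> collects what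
  stands between the outer entries, \<open>a\<close> the two traces.\<close>

lemma relations_4_of_traces:
  assumes q: "q \<in> formal F 4"
    and v: "\<And>x y. x \<in> F \<Longrightarrow> y \<in> F \<Longrightarrow>
      lin (\<lambda>xs. (Tr F (xs ! 1 * x) * Tr F (xs ! 2 * y)) *s (xs ! 0 * v * xs ! 3)) q = 0"
  shows "q \<in> tensor_relations F 4"
  unfolding relations_iff
proof (intro conjI allI impI)
  obtain s where s: "s \<in> formal F 2"
    "\<And>f. f \<in> F \<Longrightarrow> lin (\<lambda>xs. Tr F (f * xs ! 0) *s xs ! 1) s = f"
    by (rule trace_duality) blast
  fix ys :: "'a list" assume "length ys = 4"
  then obtain y1 y2 y3 y4 where ys: "ys = [y1, y2, y3, y4]"
    by (auto simp: length_Suc_conv eval_nat_numeral)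
  define w where "w ss ts = y1 * ss ! 1 * (y2 * ts ! 1 * y3)" for ss ts
  define a where "a ss ts xs = Tr F (xs ! 1 * ss ! 0) * Tr F (xs ! 2 * ts ! 0)" for ss ts xs
  have "lin (word_prod ys) q =
      lin (\<lambda>xs. lin (\<lambda>ss. lin (\<lambda>ts. a ss ts xs *s (xs ! 0 * w ss ts * xs ! 3) * y4) s) s) q"
  proof (rule lin_formal_cong[OF q])
    fix xs assume "xs \<in> tuples F 4"
    then obtain x1 x2 x3 x4 where xs: "xs = [x1, x2, x3, x4]" "x2 \<in> F" "x3 \<in> F"
      by (auto simp: tuples_4)
    have "word_prod ys xs = x1 * y1 * lin (\<lambda>ss. Tr F (x2 * ss ! 0) *s ss ! 1) s *
        (y2 * lin (\<lambda>ss. Tr F (x3 * ss ! 0) *s ss ! 1) s * (y3 * x4 * y4))"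
      unfolding s(2)[OF xs(2)] s(2)[OF xs(3)] by (simp add: ys xs mult.assoc)
    also have "\<dots> = lin (\<lambda>ss. lin (\<lambda>ts. x1 * y1 * (Tr F (x2 * ss ! 0) *s ss ! 1) *
        (y2 * (Tr F (x3 * ts ! 0) *s ts ! 1) * (y3 * x4 * y4))) s) s"
      by (simp only: lin_mult_left lin_mult_right)
    finally show "word_prod ys xs =
        lin (\<lambda>ss. lin (\<lambda>ts. a ss ts xs *s (xs ! 0 * w ss ts * xs ! 3) * y4) s) s"
      by (simp add: xs a_def w_def scale_mult_left scale_mult_right mult.assoc
          mult.commute[where 'a='k])
  qed
  also have "\<dots> = lin (\<lambda>ss. lin (\<lambda>xs. lin (\<lambda>ts. a ss ts xs *s (xs ! 0 * w ss ts * xs ! 3) * y4) s) q) s"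
    by (rule lin_swap)
  also have "\<dots> = lin (\<lambda>ss. lin (\<lambda>ts. lin (\<lambda>xs. a ss ts xs *s (xs ! 0 * w ss ts * xs ! 3) * y4) q) s) s"
    by (subst (2) lin_swap) (rule refl)
  also have "\<dots> = lin (\<lambda>ss. lin (\<lambda>ts. 0) s) s"
  proof (rule lin_formal_cong[OF s(1)], rule lin_formal_cong[OF s(1)])
    fix ss ts assume "ss \<in> tuples F 2" "ts \<in> tuples F 2"
    then have "ss ! 0 \<in> F" "ts ! 0 \<in> F" by (auto simp: tuples_2)
    from lin_eq_0_of_generator[OF q _ _ v[OF this], of "w ss ts"]
    show "lin (\<lambda>xs. a ss ts xs *s (xs ! 0 * w ss ts * xs ! 3) * y4) q = 0"
      by (simp add: lin_mult_right a_def)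
  qed
  finally show "lin (word_prod ys) q = 0" by simp
qed (rule q)

text \<open>The equation defining c, on a representative. It governs all products, since (r v x) (y
  v s) = r (v x y v) s.\<close>

definition structure_constants :: "('a list \<Rightarrow>\<^sub>0 'k) \<Rightarrow> bool" where
  "structure_constants c \<longleftrightarrow> c \<in> formal F 3 \<and>
     (\<forall>x\<in>F. lin (\<lambda>xs. Tr F (xs ! 1 * x) *s (xs ! 0 * v * xs ! 2)) c = v * x * v)"

lemma structure_constants_exist: "\<exists>c. structure_constants c"
proof -
  obtain s where s: "s \<in> formal F 2"
    "\<And>f. f \<in> F \<Longrightarrow> lin (\<lambda>xs. Tr F (f * xs ! 0) *s xs ! 1) s = f"
    by (rule trace_duality) blast
  have "\<forall>y. \<exists>p. p \<in> formal F 2 \<and> act p v = v * y * v"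
    using act_surj by blast
  then obtain P where P: "\<And>y. P y \<in> formal F 2" "\<And>y. act (P y) v = v * y * v"
    by metis
  \<comment> \<open>\<open>P y\<close> is any preimage of v y v, evaluated only at the entries s_1
    of one representative. The tensor is sum P(s_1)_0 \<otimes> s_0 \<otimes> P(s_1)_1, whose test
    at x gives sum Tr(s_0 x) v s_1 v = v x v.\<close>
  define c where "c = (\<Sum>xs\<in>Poly_Mapping.keys s. formal_scale (Poly_Mapping.lookup s xs)
    (\<Sum>ys\<in>Poly_Mapping.keys (P (xs ! 1)).
       Poly_Mapping.single [ys ! 0, xs ! 0, ys ! 1] (1 * Poly_Mapping.lookup (P (xs ! 1)) ys)))"
  have keys: "xs ! 0 \<in> F" if "xs \<in> Poly_Mapping.keys s" for xs
  proof -
    have "xs \<in> tuples F 2" using that s(1) by (auto simp: formal_def)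
    then show ?thesis by (auto simp: tuples_2)
  qed
  have "c \<in> formal F 3"
    unfolding c_def by (intro formal_sum formal_scale_closed formal_sum_keys[OF P(1)])
      (auto simp: tuples_2 tuples_3 keys)
  moreover have "lin (\<lambda>xs. Tr F (xs ! 1 * x) *s (xs ! 0 * v * xs ! 2)) c = v * x * v"
    if x: "x \<in> F" for x
  proof -
    have "lin (\<lambda>xs. Tr F (xs ! 1 * x) *s (xs ! 0 * v * xs ! 2)) c =
        lin (\<lambda>xs. lin (\<lambda>ys. Tr F (xs ! 0 * x) *s (ys ! 0 * v * ys ! 1)) (P (xs ! 1))) s"
      unfolding c_def lin_sum lin_formal_scale lin_single by (simp add: lin_def)
    also have "\<dots> = lin (\<lambda>xs. Tr F (xs ! 0 * x) *s (v * xs ! 1 * v)) s"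
      unfolding lin_scale_fun using P(2) by (simp add: act_def)
    also have "\<dots> = lin (\<lambda>xs. v * (Tr F (x * xs ! 0) *s xs ! 1) * v) s"
      by (rule lin_formal_cong[OF s(1)])
        (auto simp: tuples_2 scale_mult_left scale_mult_right F_commute[OF x])
    also have "\<dots> = v * x * v" by (simp only: lin_mult_left lin_mult_right s(2)[OF x])
    finally show ?thesis .
  qed
  ultimately show ?thesis by (auto simp: structure_constants_def)
qed

lemma structure_constants_unique:
  assumes "structure_constants c" "structure_constants c'"
  shows "c - c' \<in> tensor_relations F 3"
  using assms unfolding structure_constants_def
  by (intro relations_3_of_traces formal_diff) (simp_all add: lin_diff)

text \<open>The product inside the trace is a_0 c_0 \<otimes> a_1 c_1 b_0 \<otimes> c_2 b_1: the
  factor a_1 b_0 lands under the trace, while a_0 and b_1 come out. Here \<open>c\<close> is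
  arbitrary, as the uniqueness statement requires.\<close>

lemma act_product:
  assumes a: "a \<in> formal F 2" and b: "b \<in> formal F 2" and c: "c \<in> formal F 3"
  shows "act (ftrace F (fmult (fmult (fface 2 a) c) (fface 0 b))) v =
    lin (\<lambda>xs. lin (\<lambda>ys. xs ! 0 *
      lin (\<lambda>zs. Tr F (zs ! 1 * (xs ! 1 * ys ! 0)) *s (zs ! 0 * v * zs ! 2)) c * ys ! 1) b) a"
proof -
  have "act (ftrace F (fmult (fmult (fface 2 a) c) (fface 0 b))) v =
    lin (\<lambda>xs. lin (\<lambda>zs. lin (\<lambda>ys. xs ! 0 *
      (Tr F (zs ! 1 * (xs ! 1 * ys ! 0)) *s (zs ! 0 * v * zs ! 2)) * ys ! 1) b) c) a"
    unfolding act_def lin_ftrace lin_fmult lin_fface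
    by (intro lin_formal_cong[OF a] lin_formal_cong[OF b] lin_formal_cong[OF c])
      (auto simp: tuples_2 tuples_3 mult.assoc scale_mult_left scale_mult_right F_left_commute)
  also have "\<dots> = lin (\<lambda>xs. lin (\<lambda>ys. lin (\<lambda>zs. xs ! 0 *
      (Tr F (zs ! 1 * (xs ! 1 * ys ! 0)) *s (zs ! 0 * v * zs ! 2)) * ys ! 1) c) b) a"
    by (subst (2) lin_swap) (rule refl)
  finally show ?thesis by (simp only: lin_mult_left lin_mult_right)
qed

lemma structure_constants_iff:
  assumes c: "c \<in> formal F 3"
  shows "structure_constants c \<longleftrightarrow> (\<forall>a\<in>formal F 2. \<forall>b\<in>formal F 2.
    act (ftrace F (fmult (fmult (fface 2 a) c) (fface 0 b))) v = act a v * act b v)"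
proof
  assume sc: "structure_constants c"
  show "\<forall>a\<in>formal F 2. \<forall>b\<in>formal F 2.
    act (ftrace F (fmult (fmult (fface 2 a) c) (fface 0 b))) v = act a v * act b v"
  proof (intro ballI)
    fix a b assume a: "a \<in> formal F 2" and b: "b \<in> formal F 2"
    have "act (ftrace F (fmult (fmult (fface 2 a) c) (fface 0 b))) v =
        lin (\<lambda>xs. lin (\<lambda>ys. (xs ! 0 * v * xs ! 1) * (ys ! 0 * v * ys ! 1)) b) a"
      unfolding act_product[OF a b c] using sc unfolding structure_constants_def
      by (intro lin_formal_cong[OF a] lin_formal_cong[OF b]) (auto simp: tuples_2 mult.assoc)
    also have "\<dots> = act a v * act b v"
      unfolding act_def by (simp only: lin_mult_left lin_mult_right)
    finally show "act (ftrace F (fmult (fmult (fface 2 a) c) (fface 0 b))) v = act a v * act b v" .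
  qed
next
  assume *: "\<forall>a\<in>formal F 2. \<forall>b\<in>formal F 2.
    act (ftrace F (fmult (fmult (fface 2 a) c) (fface 0 b))) v = act a v * act b v"
  have "lin (\<lambda>xs. Tr F (xs ! 1 * x) *s (xs ! 0 * v * xs ! 2)) c = v * x * v" if x: "x \<in> F" for x
  proof -
    \<comment> \<open>The tensors 1 \<otimes> x and 1 \<otimes> 1 act as v x and v, whose product is
      v x v.\<close>
    let ?a = "Poly_Mapping.single [1, x] 1" and ?b = "Poly_Mapping.single [1, 1 :: 'a] (1 :: 'k)"
    have ab: "?a \<in> formal F 2" "?b \<in> formal F 2"
      using x by (auto intro!: formal_single simp: tuples_2)
    from *[THEN bspec, OF ab(1), THEN bspec, OF ab(2)] show ?thesis
      unfolding act_product[OF ab c] by (simp add: act_def)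
  qed
  with c show "structure_constants c" by (simp add: structure_constants_def)
qed

text \<open>Associativity of \<open>v x v y v\<close>.\<close>

lemma structure_constants_cocycle:
  assumes sc: "structure_constants c"
  shows "fmult (fface 0 c) (fface 2 c) - fmult (fface 1 c) (fface 3 c) \<in> tensor_relations F 4"
proof (rule relations_4_of_traces)
  have c: "c \<in> formal F 3"
    and cv: "\<And>x. x \<in> F \<Longrightarrow> lin (\<lambda>xs. Tr F (xs ! 1 * x) *s (xs ! 0 * v * xs ! 2)) c = v * x * v"
    using sc by (auto simp: structure_constants_def)
  have "fface i c \<in> formal F 4" if "i \<le> 3" for i
    using fface_formal[OF c that] by simp
  then show "fmult (fface 0 c) (fface 2 c) - fmult (fface 1 c) (fface 3 c) \<in> formal F 4"
    by (intro formal_diff fmult_formal) auto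
  fix x y assume x: "x \<in> F" and y: "y \<in> F"
  define g where "g xs = (Tr F (xs ! 1 * x) * Tr F (xs ! 2 * y)) *s (xs ! 0 * v * xs ! 3)" for xs
  \<comment> \<open>With d a second copy of c, this product is d_0 \<otimes> c_0 d_1 \<otimes> c_1
    \<otimes> c_2 d_2. Summing over d first gives v c_0 x v: it is v x (v y v) with the bracket
    expanded.\<close>
  have "lin g (fmult (fface 0 c) (fface 2 c)) =
      lin (\<lambda>xs. lin (\<lambda>ys. Tr F (xs ! 1 * y) *s
        ((Tr F (ys ! 1 * (xs ! 0 * x)) *s (ys ! 0 * v * ys ! 2)) * xs ! 2)) c) c"
    unfolding lin_fmult lin_fface
    by (intro lin_formal_cong[OF c])
      (auto simp: tuples_3 g_def mult.assoc scale_mult_left F_commute F_left_commute mult.commute[where 'a='k])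
  also have "\<dots> = lin (\<lambda>xs. v * x * (Tr F (xs ! 1 * y) *s (xs ! 0 * v * xs ! 2))) c"
    unfolding lin_scale_fun lin_mult_right
    by (intro lin_formal_cong[OF c])
      (auto simp: tuples_3 cv[unfolded One_nat_def mult.assoc] x mult.assoc scale_mult_right F_left_commute[OF x])
  also have "\<dots> = v * x * v * y * v"
    by (simp only: lin_mult_left cv[OF y]) (simp add: mult.assoc)
  finally have 1: "lin g (fmult (fface 0 c) (fface 2 c)) = v * x * v * y * v" .
  \<comment> \<open>Here the tensor is c_0 d_0 \<otimes> d_1 \<otimes> c_1 d_2 \<otimes> c_2.
    Summing over c first gives d_0 v d_2 y v, from the expansion of (v x v) y v.\<close>
  have "lin g (fmult (fface 1 c) (fface 3 c)) =
      lin (\<lambda>xs. lin (\<lambda>ys. Tr F (ys ! 1 * x) *s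
        (ys ! 0 * (Tr F (xs ! 1 * (ys ! 2 * y)) *s (xs ! 0 * v * xs ! 2)))) c) c"
    unfolding lin_fmult lin_fface
    by (intro lin_formal_cong[OF c])
      (auto simp: tuples_3 g_def mult.assoc scale_mult_right F_left_commute)
  also have "\<dots> = lin (\<lambda>ys. lin (\<lambda>xs. Tr F (ys ! 1 * x) *s
        (ys ! 0 * (Tr F (xs ! 1 * (ys ! 2 * y)) *s (xs ! 0 * v * xs ! 2)))) c) c"
    by (rule lin_swap)
  also have "\<dots> = lin (\<lambda>ys. Tr F (ys ! 1 * x) *s (ys ! 0 * v * ys ! 2) * (y * v)) c"
    unfolding lin_scale_fun lin_mult_left
    by (intro lin_formal_cong[OF c])
      (auto simp: tuples_3 cv[unfolded One_nat_def mult.assoc] y mult.assoc scale_mult_left)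
  also have "\<dots> = v * x * v * y * v"
    by (simp only: lin_mult_right cv[OF x]) (simp add: mult.assoc)
  finally have 2: "lin g (fmult (fface 1 c) (fface 3 c)) = v * x * v * y * v" .
  show "lin (\<lambda>xs. (Tr F (xs ! 1 * x) * Tr F (xs ! 2 * y)) *s (xs ! 0 * v * xs ! 3))
      (fmult (fface 0 c) (fface 2 c) - fmult (fface 1 c) (fface 3 c)) = 0"
    using 1 2 unfolding g_def lin_diff by simp
qed

lemma structure_constants_regular:
  assumes sc: "structure_constants c" and t: "t \<in> formal F 3" "fmult c t \<in> tensor_relations F 3"
  shows "t \<in> tensor_relations F 3"
  unfolding relations_iff
proof (intro conjI allI impI)
  have c: "c \<in> formal F 3"
    and cv: "\<And>x. x \<in> F \<Longrightarrow> lin (\<lambda>xs. Tr F (xs ! 1 * x) *s (xs ! 0 * v * xs ! 2)) c = v * x * v"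
    using sc by (auto simp: structure_constants_def)
  \<comment> \<open>Testing c t at x puts t_1 x under the trace, and summing over c leaves v t_1 x v
    between t_0 and t_2.\<close>
  have vxv: "lin (\<lambda>ts. ts ! 0 * (v * (ts ! 1 * x) * v) * ts ! 2) t = 0" if x: "x \<in> F" for x
  proof -
    have "lin (\<lambda>xs. Tr F (xs ! 1 * x) *s (xs ! 0 * v * xs ! 2)) (fmult c t) = 0"
      using x by (intro lin_relations[OF multilinear_3I t(2)])
        (simp_all add: Tr_add Tr_scale algebra_simps scale_mult_left scale_mult_right)
    moreover have "lin (\<lambda>xs. Tr F (xs ! 1 * x) *s (xs ! 0 * v * xs ! 2)) (fmult c t) =
        lin (\<lambda>xs. lin (\<lambda>ts. ts ! 0 * (Tr F (xs ! 1 * (ts ! 1 * x)) *s (xs ! 0 * v * xs ! 2)) * ts ! 2) t) c"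
      unfolding lin_fmult
      by (intro lin_formal_cong[OF c] lin_formal_cong[OF t(1)])
        (auto simp: tuples_3 mult.assoc scale_mult_left scale_mult_right F_left_commute)
    moreover have "\<dots> = lin (\<lambda>ts. ts ! 0 * lin (\<lambda>xs. Tr F (xs ! 1 * (ts ! 1 * x)) *s (xs ! 0 * v * xs ! 2)) c * ts ! 2) t"
      unfolding lin_mult_left[symmetric] lin_mult_right[symmetric] by (rule lin_swap)
    moreover have "\<dots> = lin (\<lambda>ts. ts ! 0 * (v * (ts ! 1 * x) * v) * ts ! 2) t"
      using x by (intro lin_formal_cong[OF t(1)]) (auto simp: tuples_3 cv[unfolded One_nat_def])
    ultimately show ?thesis by simp
  qed
  fix ys :: "'a list" assume "length ys = 3"
  then obtain y1 y2 y3 where ys: "ys = [y1, y2, y3]" by (auto simp: length_Suc_conv numeral_3_eq_3)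
  obtain p1 p2 where p: "p1 \<in> formal F 2" "act p1 v = y1" "p2 \<in> formal F 2" "act p2 v = y2"
    using act_surj by metis
  \<comment> \<open>With y_1 = sum s_0 v s_1 and y_2 = sum u_0 v u_1, the elements of F commute past
    the entries of t. The middle becomes v t_1 (s_1 u_0) v, to which \<open>vxv\<close> applies with
    x = s_1 u_0.\<close>
  define h where "h ss us ts = ss ! 0 * (ts ! 0 * (v * (ts ! 1 * (ss ! 1 * us ! 0)) * v) * ts ! 2) * (us ! 1 * y3)"
    for ss us ts :: "'a list"
  have "lin (word_prod ys) t = lin (\<lambda>ts. ts ! 0 * act p1 v * ts ! 1 * act p2 v * (ts ! 2 * y3)) t"
    by (rule lin_formal_cong[OF t(1)]) (auto simp: tuples_3 ys p mult.assoc)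
  also have "\<dots> = lin (\<lambda>ts. lin (\<lambda>ss. lin (\<lambda>us. ts ! 0 * (ss ! 0 * v * ss ! 1) * ts ! 1 *
      (us ! 0 * v * us ! 1) * (ts ! 2 * y3)) p2) p1) t"
    unfolding act_def by (simp only: lin_mult_left lin_mult_right)
  also have "\<dots> = lin (\<lambda>ts. lin (\<lambda>ss. lin (\<lambda>us. h ss us ts) p2) p1) t"
  proof (rule lin_formal_cong[OF t(1)], rule lin_formal_cong[OF p(1)], rule lin_formal_cong[OF p(3)])
    fix ts ss us assume "ts \<in> tuples F 3" "ss \<in> tuples F 2" "us \<in> tuples F 2"
    then show "ts ! 0 * (ss ! 0 * v * ss ! 1) * ts ! 1 * (us ! 0 * v * us ! 1) * (ts ! 2 * y3) = h ss us ts"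
      by (auto simp: tuples_2 tuples_3 h_def mult.assoc F_left_commute)
  qed
  also have "\<dots> = lin (\<lambda>ss. lin (\<lambda>ts. lin (\<lambda>us. h ss us ts) p2) t) p1"
    by (rule lin_swap)
  also have "\<dots> = lin (\<lambda>ss. lin (\<lambda>us. lin (\<lambda>ts. h ss us ts) t) p2) p1"
    by (subst (2) lin_swap) (rule refl)
  also have "\<dots> = lin (\<lambda>ss. lin (\<lambda>us. 0) p2) p1"
    unfolding h_def lin_mult_left lin_mult_right
    by (intro lin_formal_cong[OF p(1)] lin_formal_cong[OF p(3)]) (auto simp: tuples_2 vxv[unfolded One_nat_def])
  finally show "lin (word_prod ys) t = 0" by simp
qed (rule t)

end

section \<open>Tensor powers as rings\<close>

context commutative_in_csa
begin

lemma tensor_class_eq: "tensor_class F n p = (\<lambda>r. r + p) ` tensor_relations F n"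
  by (auto simp: a_r_coset_def' formal_ring_def)

lemma tensor_class_eq_iff: "tensor_class F n p = tensor_class F n q \<longleftrightarrow> p - q \<in> tensor_relations F n"
proof
  assume "tensor_class F n p = tensor_class F n q"
  moreover have "0 + p \<in> tensor_class F n p"
    unfolding tensor_class_eq by (rule imageI) (rule formal.subspace_0[OF relations_subspace])
  ultimately obtain r where "0 + p = r + q" "r \<in> tensor_relations F n"
    unfolding tensor_class_eq by blast
  then show "p - q \<in> tensor_relations F n" by simp
next
  assume *: "p - q \<in> tensor_relations F n"
  have "(\<lambda>r. r + p) ` tensor_relations F n \<subseteq> (\<lambda>r. r + q) ` tensor_relations F n"
    if "p - q \<in> tensor_relations F n" for p q
  proof clarify
    fix r assume "r \<in> tensor_relations F n"
    with that have "r + (p - q) \<in> tensor_relations F n"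
      by (intro formal.subspace_add[OF relations_subspace])
    then show "r + p \<in> (\<lambda>r. r + q) ` tensor_relations F n"
      by (intro image_eqI[of _ _ "r + (p - q)"]) auto
  qed
  from this[OF *] this[of q p] formal.subspace_neg[OF relations_subspace *]
  show "tensor_class F n p = tensor_class F n q"
    unfolding tensor_class_eq by auto
qed

text \<open>A map of representatives that is constant modulo relations turns the union in
  \<open>induced_map\<close> into a single class.\<close>

lemma induced_map_class:
  assumes "\<And>r. r \<in> tensor_relations F n \<Longrightarrow> g (r + p) - g p \<in> tensor_relations F m"
  shows "induced_map F m g (tensor_class F n p) = tensor_class F m (g p)"
proof -
  have "tensor_class F m (g (r + p)) = tensor_class F m (g p)" if "r \<in> tensor_relations F n" for r
    using assms[OF that] by (simp only: tensor_class_eq_iff)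
  moreover have "tensor_relations F n \<noteq> {}"
    using formal.subspace_0[OF relations_subspace] by auto
  ultimately show ?thesis
    unfolding induced_map_def tensor_class_eq[of n p] by auto
qed

lemma carrier_tensor_power: "carrier (tensor_power F n) = tensor_class F n ` formal F n"
  by (auto simp: tensor_power_def Let_def FactRing_def A_RCOSETS_def' formal_ring_def formal_def)

lemma tensor_class_closed: "p \<in> formal F n \<Longrightarrow> tensor_class F n p \<in> carrier (tensor_power F n)"
  by (simp add: carrier_tensor_power)

lemma tensor_power_cases:
  assumes "X \<in> carrier (tensor_power F n)"
  obtains p where "p \<in> formal F n" "X = tensor_class F n p"
  using assms by (auto simp: carrier_tensor_power)

lemma tensor_power_add:
  "tensor_class F n p \<oplus>\<^bsub>tensor_power F n\<^esub> tensor_class F n q = tensor_class F n (p + q)"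
proof -
  have "tensor_class F n p \<oplus>\<^bsub>tensor_power F n\<^esub> tensor_class F n q =
      (\<Union>x\<in>tensor_class F n p. \<Union>y\<in>tensor_class F n q. {x + y})"
    by (simp add: tensor_power_def Let_def FactRing_def set_add_def' formal_ring_def)
  also have "\<dots> = (\<Union>r\<in>tensor_relations F n. \<Union>s\<in>tensor_relations F n. {(r + s) + (p + q)})"
    unfolding tensor_class_eq by (simp add: ac_simps)
  also have "\<dots> = tensor_class F n (p + q)"
  proof -
    have "\<exists>r'\<in>tensor_relations F n. \<exists>s\<in>tensor_relations F n. r + (p + q) = (r' + s) + (p + q)"
      if "r \<in> tensor_relations F n" for r
      using that formal.subspace_0[OF relations_subspace] by (intro bexI[of _ r] bexI[of _ 0]) auto
    then show ?thesis
      unfolding tensor_class_eq using formal.subspace_add[OF relations_subspace] by auto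
  qed
  finally show ?thesis .
qed

lemma tensor_power_mult:
  assumes p: "p \<in> formal F n" and q: "q \<in> formal F n"
  shows "tensor_class F n p \<otimes>\<^bsub>tensor_power F n\<^esub> tensor_class F n q = tensor_class F n (fmult p q)"
proof -
  \<comment> \<open>The product in the quotient is a union over all pairs of representatives; the
    ideal property makes it one class.\<close>
  have "tensor_class F n (fmult (r + p) (s + q)) = tensor_class F n (fmult p q)"
    if r: "r \<in> tensor_relations F n" and s: "s \<in> tensor_relations F n" for r s
  proof -
    have rs: "r \<in> formal F n" "s \<in> formal F n" using r s by (auto simp: relations_iff)
    have "fmult (r + p) (s + q) - fmult p q = fmult (r + p) s + fmult q r"
      using p q rs
      by (simp add: fmult_add_right[of _ n] fmult_add_left formal_add fmult_commute[of q n r])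
    then show ?thesis
      unfolding tensor_class_eq_iff using r s p q rs
      by (auto intro!: formal.subspace_add[OF relations_subspace] fmult_relations formal_add)
  qed
  moreover have "tensor_relations F n \<noteq> {}"
    using formal.subspace_0[OF relations_subspace] by auto
  moreover have "tensor_class F n p \<otimes>\<^bsub>tensor_power F n\<^esub> tensor_class F n q =
      (\<Union>x\<in>tensor_class F n p. \<Union>y\<in>tensor_class F n q. tensor_class F n (fmult x y))"
    by (simp add: tensor_power_def Let_def FactRing_def rcoset_mult_def formal_ring_def fmult_def)
  ultimately show ?thesis
    unfolding tensor_class_eq[of n p] tensor_class_eq[of n q] by auto
qed

lemma tensor_power_one: "\<one>\<^bsub>tensor_power F n\<^esub> = tensor_class F n (Poly_Mapping.single (replicate n 1) 1)"
  by (simp add: tensor_power_def Let_def FactRing_def formal_ring_def)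

lemma tensor_power_smult:
  "a \<odot>\<^bsub>tensor_power F n\<^esub> tensor_class F n p = tensor_class F n (formal_scale a p)"
proof -
  have "a \<odot>\<^bsub>tensor_power F n\<^esub> tensor_class F n p = induced_map F n (formal_scale a) (tensor_class F n p)"
    by (simp add: tensor_power_def Let_def induced_map_def)
  also have "\<dots> = tensor_class F n (formal_scale a p)"
    by (rule induced_map_class)
      (simp add: formal.scale_right_distrib formal.subspace_scale[OF relations_subspace])
  finally show ?thesis .
qed

text \<open>Makes the units a commutative group, in which \<open>Delta_Am\<close> is a finite
  product.\<close>

lemma tensor_power_comm_monoid: "comm_monoid (tensor_power F n)"
proof (rule comm_monoidI)
  fix X Y assume "X \<in> carrier (tensor_power F n)" "Y \<in> carrier (tensor_power F n)"
  then obtain p q where pq: "p \<in> formal F n" "X = tensor_class F n p"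
    "q \<in> formal F n" "Y = tensor_class F n q"
    by (metis tensor_power_cases)
  then show "X \<otimes>\<^bsub>tensor_power F n\<^esub> Y \<in> carrier (tensor_power F n)"
    by (simp add: tensor_power_mult tensor_class_closed fmult_formal)
  show "X \<otimes>\<^bsub>tensor_power F n\<^esub> Y = Y \<otimes>\<^bsub>tensor_power F n\<^esub> X"
    using pq by (simp add: tensor_power_mult fmult_commute)
  fix Z assume "Z \<in> carrier (tensor_power F n)"
  then obtain r where "r \<in> formal F n" "Z = tensor_class F n r" by (rule tensor_power_cases)
  with pq show "X \<otimes>\<^bsub>tensor_power F n\<^esub> Y \<otimes>\<^bsub>tensor_power F n\<^esub> Z =
      X \<otimes>\<^bsub>tensor_power F n\<^esub> (Y \<otimes>\<^bsub>tensor_power F n\<^esub> Z)"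
    by (simp add: tensor_power_mult fmult_formal fmult_assoc)
next
  show "\<one>\<^bsub>tensor_power F n\<^esub> \<in> carrier (tensor_power F n)"
    unfolding tensor_power_one by (rule tensor_class_closed[OF one_formal])
  fix X assume "X \<in> carrier (tensor_power F n)"
  then obtain p where "p \<in> formal F n" "X = tensor_class F n p" by (rule tensor_power_cases)
  then show "\<one>\<^bsub>tensor_power F n\<^esub> \<otimes>\<^bsub>tensor_power F n\<^esub> X = X"
    by (simp add: tensor_power_one tensor_power_mult one_formal fmult_one)
qed

lemma fface_add: "fface i (p + q) = fface i p + fface i q"
  by (rule formal_eqI) (simp add: lin_fface lin_add)

lemma ftrace_add: "ftrace F (p + q) = ftrace F p + ftrace F q"
  by (rule formal_eqI) (simp add: lin_ftrace lin_add)

lemma face_class: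
  assumes "i \<le> n + 1"
  shows "face F n i (tensor_class F (n + 1) p) = tensor_class F (n + 2) (fface i p)"
proof -
  have "face F n i (tensor_class F (n + 1) p) = induced_map F (n + 2) (fface i) (tensor_class F (n + 1) p)"
    by (simp add: face_def fface_def[abs_def])
  also have "\<dots> = tensor_class F (n + 2) (fface i p)"
    using assms fface_relations[of _ "n + 1" i]
    by (intro induced_map_class) (simp add: fface_add)
  finally show ?thesis .
qed

lemma Tr32_class: "Tr32 F (tensor_class F 3 p) = tensor_class F 2 (ftrace F p)"
proof -
  have "Tr32 F (tensor_class F 3 p) = induced_map F 2 (ftrace F) (tensor_class F 3 p)"
    by (simp add: Tr32_def ftrace_def[abs_def])
  also have "\<dots> = tensor_class F 2 (ftrace F p)"
    by (intro induced_map_class) (simp add: ftrace_add ftrace_relations)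
  finally show ?thesis .
qed

lemma act_relations: "r \<in> tensor_relations F 2 \<Longrightarrow> act r z = 0"
  unfolding act_def
  by (rule lin_relations[OF multilinear_2I])
    (simp_all add: algebra_simps scale_mult_left scale_mult_right)

lemma act_add: "act (p + q) z = act p z + act q z"
  by (simp add: act_def lin_add)

text \<open>The image set inside \<open>Phi\<close> is a singleton because relations act as
  zero.\<close>

lemma Phi_class: "Phi z (tensor_class F 2 p) = act p z"
proof -
  have "(\<lambda>p. \<Sum>xs\<in>Poly_Mapping.keys p. Poly_Mapping.lookup p xs *s (xs ! 0 * z * xs ! 1))
      ` tensor_class F 2 p = (\<lambda>p. act p z) ` tensor_class F 2 p"
    by (simp add: act_def lin_def)
  also have "\<dots> = {act p z}"
    unfolding tensor_class_eq image_image using formal.subspace_0[OF relations_subspace, of F 2]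
    by (auto simp: act_add act_relations image_iff)
  finally show ?thesis by (simp add: Phi_def)
qed

lemma cocycle_mult_class:
  assumes "a \<in> formal F 2" "b \<in> formal F 2" "c \<in> formal F 3"
  shows "cocycle_mult F (tensor_class F 3 c) (tensor_class F 2 a) (tensor_class F 2 b) =
    tensor_class F 2 (ftrace F (fmult (fmult (fface 2 a) c) (fface 0 b)))"
proof -
  have "face F 1 2 (tensor_class F 2 a) = tensor_class F 3 (fface 2 a)"
    "face F 1 0 (tensor_class F 2 b) = tensor_class F 3 (fface 0 b)"
    using face_class[of 2 1 a] face_class[of 0 1 b] by (simp_all add: eval_nat_numeral)
  moreover have "fface 2 a \<in> formal F 3" "fface 0 b \<in> formal F 3"
    using fface_formal[OF assms(1), of 2] fface_formal[OF assms(2), of 0] by simp_all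
  ultimately show ?thesis
    using assms(3) by (simp add: cocycle_mult_def tensor_power_mult fmult_formal Tr32_class)
qed

lemma C_Am_comm_group: "comm_group (C_Am F n)"
  unfolding C_Am_def by (rule comm_monoid.units_comm_group[OF tensor_power_comm_monoid])

text \<open>A face map is multiplicative and sends the tuple of ones to a tuple of ones, so it maps
  inverses to inverses. The product in \<open>Delta_Am\<close> needs its factors in the
  carrier.\<close>

lemma face_unit:
  assumes X: "X \<in> carrier (C_Am F n)" and i: "i \<le> n + 1"
  shows "face F n i X \<in> carrier (C_Am F (n + 1))"
proof -
  obtain Y where "X \<in> carrier (tensor_power F (n + 1))" "Y \<in> carrier (tensor_power F (n + 1))"
      "X \<otimes>\<^bsub>tensor_power F (n + 1)\<^esub> Y = \<one>\<^bsub>tensor_power F (n + 1)\<^esub>"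
    using X by (auto simp: C_Am_def units_of_carrier Units_def)
  then obtain p q where pq: "p \<in> formal F (n + 1)" "X = tensor_class F (n + 1) p"
      "q \<in> formal F (n + 1)"
      "tensor_class F (n + 1) (fmult p q) = tensor_class F (n + 1) (Poly_Mapping.single (replicate (n + 1) 1) 1)"
    by (metis tensor_power_cases tensor_power_mult tensor_power_one)
  have f: "fface i r \<in> formal F (n + 2)" if "r \<in> formal F (n + 1)" for r
    using fface_formal[OF that i] by simp
  have "take i (replicate (n + 1) 1) @ 1 # drop i (replicate (n + 1) 1) = replicate (n + 2) (1 :: 'a)"
    using i by (intro nth_equalityI) (auto simp: nth_append nth_Cons')
  then have "fface i (Poly_Mapping.single (replicate (n + 1) 1) 1) = Poly_Mapping.single (replicate (n + 2) 1) 1"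
    by (simp add: fface_def)
  then have "tensor_class F (n + 2) (fmult (fface i p) (fface i q)) = \<one>\<^bsub>tensor_power F (n + 2)\<^esub>"
    unfolding fmult_fface[OF pq(1,3) i, symmetric] tensor_power_one face_class[OF i, symmetric] pq(4)
    by (simp only: face_class[OF i])
  then have "tensor_class F (n + 2) (fface i p) \<otimes>\<^bsub>tensor_power F (n + 2)\<^esub> tensor_class F (n + 2) (fface i q)
      = \<one>\<^bsub>tensor_power F (n + 2)\<^esub>"
    by (simp only: tensor_power_mult[OF f[OF pq(1)] f[OF pq(3)]])
  moreover from this have "tensor_class F (n + 2) (fface i q) \<otimes>\<^bsub>tensor_power F (n + 2)\<^esub> tensor_class F (n + 2) (fface i p)
      = \<one>\<^bsub>tensor_power F (n + 2)\<^esub>"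
    by (simp only: tensor_power_mult[OF f[OF pq(1)] f[OF pq(3)]] tensor_power_mult[OF f[OF pq(3)] f[OF pq(1)]]
        fmult_commute[OF f[OF pq(3)] f[OF pq(1)]])
  ultimately have "tensor_class F (n + 2) (fface i p) \<in> Units (tensor_power F (n + 2))"
    unfolding Units_def using tensor_class_closed f pq(1,3) by blast
  then show ?thesis
    unfolding pq(2) face_class[OF i] by (simp add: C_Am_def units_of_carrier)
qed

end

section \<open>The isomorphism onto A and the cocycle condition\<close>

context generated_csa
begin

text \<open>Bijectivity and linearity of \<open>Phi v\<close> do not involve c. Multiplicativity
  does, and it is \<open>structure_constants_iff\<close> on classes.\<close>

lemma algebra_iso_iff:
  assumes c: "c \<in> formal F 3"
  shows "algebra_iso (cocycle_algebra F (tensor_class F 3 c)) (Phi v) \<longleftrightarrow> structure_constants c"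
proof -
  let ?T = "tensor_power F 2"
  let ?A = "cocycle_algebra F (tensor_class F 3 c)"
  let ?m = "cocycle_mult F (tensor_class F 3 c)"
  have A: "carrier ?A = carrier ?T" "monoid.mult ?A = ?m" "add ?A = add ?T"
    "module.smult ?A = module.smult ?T"
    by (simp_all add: cocycle_algebra_def)
  have Phi_mult: "Phi v (?m (tensor_class F 2 a) (tensor_class F 2 b)) =
      act (ftrace F (fmult (fmult (fface 2 a) c) (fface 0 b))) v"
    if "a \<in> formal F 2" "b \<in> formal F 2" for a b
    using that by (simp add: cocycle_mult_class c Phi_class)
  show ?thesis
  proof
    assume "algebra_iso ?A (Phi v)"
    then have mult: "Phi v (?m X Y) = Phi v X * Phi v Y" if "X \<in> carrier ?T" "Y \<in> carrier ?T" for X Y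
      using that by (simp add: algebra_iso_def A)
    show "structure_constants c"
      unfolding structure_constants_iff[OF c]
    proof (intro ballI)
      fix a b assume "a \<in> formal F 2" "b \<in> formal F 2"
      with mult[of "tensor_class F 2 a" "tensor_class F 2 b"]
      show "act (ftrace F (fmult (fmult (fface 2 a) c) (fface 0 b))) v = act a v * act b v"
        by (simp add: Phi_mult Phi_class tensor_class_closed)
    qed
  next
    assume sc: "structure_constants c"
    have mult: "Phi v (?m X Y) = Phi v X * Phi v Y" if "X \<in> carrier ?T" "Y \<in> carrier ?T" for X Y
      using that sc Phi_mult unfolding structure_constants_iff[OF c] carrier_tensor_power
      by (auto simp: Phi_class)
    have closed: "?m X Y \<in> carrier ?T" if XY: "X \<in> carrier ?T" "Y \<in> carrier ?T" for X Y
    proof -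
      have "fface 2 a \<in> formal F 3" "fface 0 a \<in> formal F 3" if "a \<in> formal F 2" for a
        using fface_formal[OF that, of 2] fface_formal[OF that, of 0] by simp_all
      then show ?thesis
        using XY unfolding carrier_tensor_power
        by (auto simp: cocycle_mult_class c intro!: imageI ftrace_formal fmult_formal)
    qed
    have inj: "inj_on (Phi v) (carrier ?T)"
    proof (rule inj_onI)
      fix X Y assume "X \<in> carrier ?T" "Y \<in> carrier ?T" and eq: "Phi v X = Phi v Y"
      then obtain p q where pq: "p \<in> formal F 2" "X = tensor_class F 2 p"
        "q \<in> formal F 2" "Y = tensor_class F 2 q" by (metis tensor_power_cases)
      have "act (p - q) v = 0"
        using eq by (simp add: pq Phi_class act_def lin_diff)
      with pq show "X = Y"
        by (simp only: tensor_class_eq_iff act_inj formal_diff)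
    qed
    have "z \<in> Phi v ` carrier ?T" for z
    proof -
      obtain p where "p \<in> formal F 2" "act p v = z" using act_surj by blast
      then show ?thesis
        by (intro image_eqI[of _ _ "tensor_class F 2 p"]) (simp_all add: Phi_class tensor_class_closed)
    qed
    then have surj: "Phi v ` carrier ?T = UNIV" by blast
    \<comment> \<open>A bijective multiplicative map transports 1 back to a two-sided unit
      \<open>U\<close>, which gives the \<open>THE\<close> in \<open>cocycle_algebra\<close> its
      value.\<close>
    have "1 \<in> Phi v ` carrier ?T" using surj by simp
    then obtain U where U: "U \<in> carrier ?T" "Phi v U = 1" by force
    have unit: "?m U X = X \<and> ?m X U = X" if "X \<in> carrier ?T" for X
      using that U by (intro conjI inj_onD[OF inj]) (simp_all add: mult closed)
    have "\<one>\<^bsub>?A\<^esub> = U"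
      unfolding cocycle_algebra_def module.simps monoid.simps
      by (simp, rule the_equality) (use unit U(1) in metis)+
    moreover have "Phi v (X \<oplus>\<^bsub>?T\<^esub> Y) = Phi v X + Phi v Y" if "X \<in> carrier ?T" "Y \<in> carrier ?T" for X Y
      using that unfolding carrier_tensor_power by (auto simp: tensor_power_add Phi_class act_add)
    moreover have "Phi v (a \<odot>\<^bsub>?T\<^esub> X) = a *s Phi v X" if "X \<in> carrier ?T" for a X
      using that unfolding carrier_tensor_power
      by (auto simp: tensor_power_smult Phi_class act_def lin_formal_scale)
    ultimately show "algebra_iso ?A (Phi v)"
      using inj surj mult U(2) by (simp add: algebra_iso_def A bij_betw_def)
  qed
qed

text \<open>Once c is a unit, its faces lie in a commutative group. The exponents are 1, -1, 1, -1,
  so the coboundary is trivial when the faces 0 and 2 have the same product as the faces 1 and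
  3.\<close>

lemma structure_constants_Z_Am:
  assumes sc: "structure_constants c"
  shows "tensor_class F 3 c \<in> Z_Am F 2"
proof -
  let ?C = "tensor_class F 3 c"
  have c: "c \<in> formal F 3" using sc by (simp add: structure_constants_def)
  obtain t where t: "t \<in> formal F 3"
    "fmult c t - Poly_Mapping.single (replicate 3 1) 1 \<in> tensor_relations F 3"
    using regular_imp_unit[OF c structure_constants_regular[OF sc]] by blast
  have "?C \<otimes>\<^bsub>tensor_power F 3\<^esub> tensor_class F 3 t = \<one>\<^bsub>tensor_power F 3\<^esub>"
    "tensor_class F 3 t \<otimes>\<^bsub>tensor_power F 3\<^esub> ?C = \<one>\<^bsub>tensor_power F 3\<^esub>"
    using t(2) unfolding tensor_power_one tensor_power_mult[OF c t(1)] tensor_power_mult[OF t(1) c]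
      fmult_commute[OF t(1) c] tensor_class_eq_iff by simp_all
  then have "?C \<in> Units (tensor_power F 3)"
    unfolding Units_def using tensor_class_closed c t(1) by blast
  then have C: "?C \<in> carrier (C_Am F 2)"
    by (simp add: C_Am_def units_of_carrier)
  define G where "G = C_Am F 3"
  interpret G: comm_group G unfolding G_def by (rule C_Am_comm_group)
  define f where "f i = face F 2 i ?C" for i
  have f: "f i \<in> carrier G" if "i \<le> 3" for i
    using face_unit[OF C, of i] that by (simp add: f_def G_def)
  have f_class: "f i = tensor_class F 4 (fface i c)" if "i \<le> 3" for i
    using face_class[of i 2 c] that by (simp add: f_def)
  have fface: "fface i c \<in> formal F 4" if "i \<le> 3" for i
    using fface_formal[OF c that] by simp
  have "f 0 \<otimes>\<^bsub>G\<^esub> f 2 = f 1 \<otimes>\<^bsub>G\<^esub> f 3"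
    using structure_constants_cocycle[OF sc]
    by (simp add: G_def C_Am_def units_of_mult f_class fface tensor_power_mult tensor_class_eq_iff)
  moreover have "Delta_Am F 2 ?C = f 0 \<otimes>\<^bsub>G\<^esub> (inv\<^bsub>G\<^esub> f 1 \<otimes>\<^bsub>G\<^esub> (f 2 \<otimes>\<^bsub>G\<^esub> inv\<^bsub>G\<^esub> f 3))"
  proof -
    have "{0..2 + 1} = insert 0 (insert 1 (insert 2 {3 :: nat}))" by auto
    then have "Delta_Am F 2 ?C =
      (\<Otimes>\<^bsub>G\<^esub>i\<in>insert 0 (insert 1 (insert 2 {3 :: nat})). f i [^]\<^bsub>G\<^esub> ((- 1) ^ i :: int))"
      by (simp add: Delta_Am_def G_def f_def)
    also have "\<dots> = f 0 \<otimes>\<^bsub>G\<^esub> (inv\<^bsub>G\<^esub> f 1 \<otimes>\<^bsub>G\<^esub> (f 2 \<otimes>\<^bsub>G\<^esub> inv\<^bsub>G\<^esub> f 3))"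
      using f by (simp add: G.int_pow_neg)
    finally show ?thesis .
  qed
  moreover have "\<dots> = (f 0 \<otimes>\<^bsub>G\<^esub> f 2) \<otimes>\<^bsub>G\<^esub> (inv\<^bsub>G\<^esub> f 1 \<otimes>\<^bsub>G\<^esub> inv\<^bsub>G\<^esub> f 3)"
    using f by (simp add: G.m_ac)
  moreover have "(f 1 \<otimes>\<^bsub>G\<^esub> f 3) \<otimes>\<^bsub>G\<^esub> (inv\<^bsub>G\<^esub> f 1 \<otimes>\<^bsub>G\<^esub> inv\<^bsub>G\<^esub> f 3) = \<one>\<^bsub>G\<^esub>"
    using f by (simp add: G.inv_mult[symmetric])
  ultimately have "Delta_Am F 2 ?C = \<one>\<^bsub>C_Am F (2 + 1)\<^esub>"
    by (simp add: G_def)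
  with C show ?thesis by (simp add: Z_Am_def kernel_def)
qed

end

theorem theorem3p6:
  fixes scale :: "'k::field \<Rightarrow> 'a::ring_1 \<Rightarrow> 'a" and F :: "'a set" and v :: 'a
  assumes "central_simple_algebra scale"
    and "k_algebra.maximal_comm_subalgebra scale F"
    and "k_algebra.etale_subalgebra scale F"
    and "k_algebra.bimodule_span scale F v = UNIV"
  shows "\<exists>c \<in> k_algebra.Z_Am scale F 2.
           k_algebra.algebra_iso scale (k_algebra.cocycle_algebra scale F c)
             (k_algebra.Phi scale v) \<and>
           (\<forall>c' \<in> carrier (k_algebra.tensor_power scale F 3).
              k_algebra.algebra_iso scale (k_algebra.cocycle_algebra scale F c')
                (k_algebra.Phi scale v) \<longrightarrow> c' = c)"
proof -
  interpret central_simple_algebra scale by (rule assms(1))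
  interpret generated_csa scale F v
    using assms(2-4) by unfold_locales (simp_all add: maximal_comm_subalgebra_def)
  obtain c where sc: "structure_constants c" using structure_constants_exist by blast
  then have c: "c \<in> formal F 3" by (simp add: structure_constants_def)
  show ?thesis
  proof (intro bexI conjI ballI impI)
    show "tensor_class F 3 c \<in> Z_Am F 2" by (rule structure_constants_Z_Am[OF sc])
    show "algebra_iso (cocycle_algebra F (tensor_class F 3 c)) (Phi v)"
      by (simp only: algebra_iso_iff[OF c] sc)
    fix C' assume "C' \<in> carrier (tensor_power F 3)"
    then obtain c' where c': "c' \<in> formal F 3" "C' = tensor_class F 3 c'" by (rule tensor_power_cases)
    assume "algebra_iso (cocycle_algebra F C') (Phi v)"
    \<comment> \<open>The equivalence holds for any representative, cocycle or not, so uniqueness is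
      obtained among all elements of the third tensor power.\<close>
    then have "structure_constants c'" by (simp only: c' algebra_iso_iff)
    from structure_constants_unique[OF this sc] show "C' = tensor_class F 3 c"
      by (simp only: c' tensor_class_eq_iff)
  qed
qed

end
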